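(* Let $\Psi_0,\Psi_1\in C^\infty([-\pi,\pi])$ be real. Then there exists a unique real $\Psi\in\mathcal S(T)$ solving $$\frac{\partial^2\Psi}{\partial t^2}-\frac{\partial^2\Psi}{\partial x^2}=0$$ with $\Psi(x,0)=\Psi_0(x)$ and $\frac{\partial\Psi}{\partial t}(x,0)=\Psi_1(x)$ for $x\in[-\pi,\pi)$. Moreover $\Psi$ is given explicitly by $$\Psi(x,t)=a_0+ta_0'+2\sum_{m>0}a_m\cos(mx)\cos(mt)+2\sum_{m>0}b_m\sin(mx)\cos(mt)+2\sum_{m>0}\frac{a_m'}{m}\cos(mx)\sin(mt)+2\sum_{m>0}\frac{b_m'}{m}\sin(mx)\sin(mt).$$ For such a solution $\Psi$, set $\rho(x,t)=\Psi(x,t)$ and $J(x,t)=\int_{-\pi}^x-\frac{\partial\rho}{\partial t}(y,t)\,dy$. Then $\{\rho,J\}$ satisfy the continuity equation $\frac{\partial\rho}{\partial t}+\frac{\partial J}{\partial x}=0$. In particular, if $P(t)=\int_{-\pi}^{\pi}\rho(x,t)\,dx$, then $P(t)=P(0)$ is constant. Moreover, when $\Psi_0$ and $\Psi_1$ are symmetric (even), one has the additional relation $\frac{\partial J}{\partial t}=-\frac{\partial\rho}{\partial x}$, the function $J$ also satisfies the wave equation with $J\in\mathcal S(T)$, and $$\rho(x,t)=a_0+a_0't+2\sum_{m>0}a_m\cos(mx)\cos(mt)+2\sum_{m>0}\frac{a_m'}{m}\cos(mx)\sin(mt),$$ $$J(x,t)=-a_0'\pi-a_0'x+2\sum_{m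>0}a_m\sin(mx)\sin(mt)-2\sum_{m>0}\frac{a_m'}{m}\sin(mx)\cos(mt).$$
   Context: The interval $[-\pi,\pi]$ is regarded as the circle (endpoints identified), and the initial data and the solution $\Psi(\cdot,t)$ are understood as smooth functions on the circle. $T=[-\pi,\pi]\times\mathbb R$ with interior $T^0=(-\pi,\pi)\times\mathbb R$. $C(T)$ is the set of continuous $G$ on $T$ with $G_t=G(\cdot,t)\in C([-\pi,\pi])$ for each $t\in\mathbb R$, and $\mathcal S(T)=\{G\in C(T): G_t\in C^\infty([-\pi,\pi])\text{ for all }t\in\mathbb R,\ G|_{T^0}\in C^\infty(T^0)\}$. The coefficients, for integers $m\ge0$, are $a_m=\frac1{2\pi}\int_{-\pi}^{\pi}\Psi_0(x)\cos(mx)dx$, $b_m=\frac1{2\pi}\int_{-\pi}^{\pi}\Psi_0(x)\sin(mx)dx$, $a_m'=\frac1{2\pi}\int_{-\pi}^{\pi}\Psi_1(x)\cos(mx)dx$, $b_m'=\frac1{2\pi}\int_{-\pi}^{\pi}\Psi_1(x)\sin(mx)dx$. Sums are over positive integers $m$.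
   Formalization: P(t)=P(0) fails in general (Ψ_0=0, Ψ_1=1 gives Ψ=t, P(t)=2πt); proved instead: P is constant if and only if a_0'=0. J∈S(T) is read with smoothness up to the end points of [-π,π]; J is smooth on the circle if and only if a_0'=0. *)

theory Defs
  imports "HOL-Analysis.Analysis"
begin

text \<open>Derivatives are taken relative to \<open>S\<close>: on an open set this is ordinary differentiability of
  class \<open>C^n\<close>, on a compact interval of the real line it is \<open>C^n\<close> up to the end points, with
  one-sided derivatives there.  Only sets on which derivatives within the set are unique are
  used below.\<close>

primrec Ck_on :: "nat \<Rightarrow> ('a::real_normed_vector \<Rightarrow> real) \<Rightarrow> 'a set \<Rightarrow> bool" where
  "Ck_on 0 f S \<longleftrightarrow> continuous_on S f"
| "Ck_on (Suc n) f S \<longleftrightarrow>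
     (\<exists>f'. (\<forall>x\<in>S. (f has_derivative f' x) (at x within S)) \<and>
           (\<forall>v. Ck_on n (\<lambda>x. f' x v) S))"

definition smooth_on :: "'a::real_normed_vector set \<Rightarrow> ('a \<Rightarrow> real) \<Rightarrow> bool" where
  "smooth_on S f \<longleftrightarrow> (\<forall>n. Ck_on n f S)"

text \<open>A smooth function on the circle obtained from \<open>[-\<pi>,\<pi>]\<close> by identifying the end points is
  a function on the interval whose \<open>2\<pi>\<close>-periodic extension is smooth on the real line.\<close>

definition smooth_on_circle :: "(real \<Rightarrow> real) \<Rightarrow> bool" where
  "smooth_on_circle f \<longleftrightarrow>
     (\<exists>g. smooth_on UNIV g \<and> (\<forall>x. g (x + 2 * pi) = g x) \<and> (\<forall>x\<in>{-pi..pi}. f x = g x))"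

definition strip :: "(real \<times> real) set" where
  "strip = {-pi..pi} \<times> UNIV"

definition strip_interior :: "(real \<times> real) set" where
  "strip_interior = {-pi<..<pi} \<times> UNIV"

definition C_strip :: "(real \<times> real \<Rightarrow> real) set" where
  "C_strip = {G. continuous_on strip G \<and> (\<forall>t. continuous_on {-pi..pi} (\<lambda>x. G (x, t)))}"

text \<open>Here \<open>C^\<infinity>([-\<pi>,\<pi>])\<close> means smooth up to the end points of the interval; smoothness across
  the identified end points is a separate requirement, imposed on the data and on the solution
  in \<open>wave_solution\<close>.  (The function \<open>x \<mapsto> -a\<^sub>0' (\<pi> + x)\<close> occurring in the current is smooth on the
  interval but in general not on the circle.)\<close>

definition S_strip :: "(real \<times> real \<Rightarrow> real) set" where
  "S_strip = {G \<in> C_strip. (\<forall>t. smooth_on {-pi..pi} (\<lambda>x. G (x, t))) \<and> smooth_on strip_interior G}"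

definition wave_equation :: "(real \<times> real \<Rightarrow> real) \<Rightarrow> bool" where
  "wave_equation G \<longleftrightarrow>
     (\<forall>(x, t) \<in> strip_interior.
        deriv (\<lambda>s. deriv (\<lambda>r. G (x, r)) s) t - deriv (\<lambda>y. deriv (\<lambda>z. G (z, t)) y) x = 0)"

definition wave_solution ::
    "(real \<Rightarrow> real) \<Rightarrow> (real \<Rightarrow> real) \<Rightarrow> (real \<times> real \<Rightarrow> real) \<Rightarrow> bool" where
  "wave_solution \<Psi>0 \<Psi>1 \<Psi> \<longleftrightarrow>
     \<Psi> \<in> S_strip \<and> (\<forall>t. smooth_on_circle (\<lambda>x. \<Psi> (x, t))) \<and>
     wave_equation \<Psi> \<and>
     (\<forall>x\<in>{-pi..<pi}. \<Psi> (x, 0) = \<Psi>0 x) \<and>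
     (\<forall>x\<in>{-pi..<pi}. ((\<lambda>t. \<Psi> (x, t)) has_real_derivative \<Psi>1 x) (at 0))"

definition fourier_cos :: "(real \<Rightarrow> real) \<Rightarrow> nat \<Rightarrow> real" where
  "fourier_cos f m = 1 / (2 * pi) * integral {-pi..pi} (\<lambda>x. f x * cos (real m * x))"

definition fourier_sin :: "(real \<Rightarrow> real) \<Rightarrow> nat \<Rightarrow> real" where
  "fourier_sin f m = 1 / (2 * pi) * integral {-pi..pi} (\<lambda>x. f x * sin (real m * x))"

definition current :: "(real \<times> real \<Rightarrow> real) \<Rightarrow> real \<times> real \<Rightarrow> real" where
  "current \<rho> = (\<lambda>(x, t). integral {-pi..x} (\<lambda>y. - deriv (\<lambda>s. \<rho> (y, s)) t))"

end

theory Submission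
  imports Defs
begin

text \<open>On the open strip a smooth solution is \<open>F (x + t) + G (x - t)\<close>, and by continuity the same
  holds on the closed strip.  Matching values and first derivatives at \<open>x = \<plusminus>\<pi>\<close> for all
  times forces \<open>F'\<close> and \<open>G'\<close> to be \<open>2\<pi>\<close>-periodic, so they are determined by the data on one period
  and the solution is d'Alembert's.  With \<open>H' = \<Psi>\<^sub>1\<close>, the function \<open>H x - a\<^sub>0' x\<close> is smooth and
  periodic, and the series come from the Fourier expansions of it and of \<open>\<Psi>\<^sub>0\<close> at \<open>x \<plusminus> t\<close>.\<close>

section \<open>Functions of class Ck\<close>

text \<open>The equation and joint smoothness are given only on the open strip, while the gluing
  takes place at the end points. The identities needed there are proved for interior
  \<open>x\<close>, carried to the ends by continuity and then to the whole line by periodicity. Two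
  unknown profiles require two gluing relations: the \<open>x\<close> derivative of a time slice
  controls F'(x + t) + G'(x - t), and differentiating the equality of boundary values in time
  controls F'(x + t) - G'(x - t). F and G themselves need not be periodic, since \<open>H\<close>
  gains 2 pi a_0' per period. This gain cancels in H (x + t) - H (x - t), so the solution stays on
  the circle, but it leaves the term t a_0' and makes the total P(t) equal to 2 pi (a_0 + t a_0').
  Hence P is constant exactly when a_0' = 0. For even data the same number decides whether J closes
  up on the circle. Both facts are therefore proved as equivalences.\<close>

lemma Ck_on_cong:
  assumes "\<And>x. x \<in> S \<Longrightarrow> f x = g x" and "Ck_on n f S"
  shows "Ck_on n g S"
proof (cases n)
  case 0
  then show ?thesis using assms continuous_on_cong[of S S f g] by simp
next
  case (Suc k)
  then obtain f' where f': "\<And>x. x \<in> S \<Longrightarrow> (f has_derivative f' x) (at x within S)"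
    "\<And>v. Ck_on k (\<lambda>x. f' x v) S"
    using assms(2) by auto
  have "(g has_derivative f' x) (at x within S)" if "x \<in> S" for x
    by (rule has_derivative_transform[OF that _ f'(1)[OF that]]) (simp add: assms(1))
  with f'(2) Suc show ?thesis by auto
qed

lemma Ck_on_const: "Ck_on n (\<lambda>x. c) S"
  by (induction n arbitrary: c) (auto intro!: exI[of _ "\<lambda>_ _. 0"])

lemma Ck_on_add:
  assumes "Ck_on n f S" "Ck_on n g S"
  shows "Ck_on n (\<lambda>x. f x + g x) S"
  using assms
proof (induction n arbitrary: f g)
  case 0
  then show ?case by (auto intro: continuous_on_add)
next
  case (Suc n)
  then obtain f' g' where "\<And>x. x \<in> S \<Longrightarrow> (f has_derivative f' x) (at x within S)"
    "\<And>v. Ck_on n (\<lambda>x. f' x v) S" "\<And>x. x \<in> S \<Longrightarrow> (g has_derivative g' x) (at x within S)"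
    "\<And>v. Ck_on n (\<lambda>x. g' x v) S"
    unfolding Ck_on.simps by blast
  with Suc.IH show ?case
    by (auto intro!: exI[of _ "\<lambda>x v. f' x v + g' x v"] has_derivative_add)
qed

lemma Ck_on_cmult:
  assumes "Ck_on n f S"
  shows "Ck_on n (\<lambda>x. c * f x) S"
  using assms
proof (induction n arbitrary: f)
  case 0
  then show ?case by (auto intro: continuous_on_mult_left)
next
  case (Suc n)
  then obtain f' where "\<And>x. x \<in> S \<Longrightarrow> (f has_derivative f' x) (at x within S)"
    "\<And>v. Ck_on n (\<lambda>x. f' x v) S"
    by auto
  with Suc.IH show ?case
    by (auto intro!: exI[of _ "\<lambda>x v. c * f' x v"] has_derivative_mult_right)
qed

text \<open>Differentiating in direction \<open>v\<close> gives \<open>f'\<close> in the fixed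
  direction \<open>L v\<close>, composed with the same affine map, so the induction closes. It
  serves both translates on an interval and waves such as F (x + t) on the strip.\<close>

lemma Ck_on_affine:
  assumes "bounded_linear L" "Ck_on n f UNIV"
  shows "Ck_on n (\<lambda>p. f (L p + c)) S"
  using assms(2)
proof (induction n arbitrary: f)
  case 0
  then have "continuous_on UNIV f" by simp
  then have "continuous_on S (f \<circ> (\<lambda>p. L p + c))"
    by (intro continuous_on_compose continuous_on_add continuous_on_const
        linear_continuous_on[OF assms(1)]) (auto elim: continuous_on_subset)
  then show ?case by (simp add: o_def)
next
  case (Suc n)
  then obtain f' where f': "\<And>x. (f has_derivative f' x) (at x)"
    "\<And>v. Ck_on n (\<lambda>x. f' x v) UNIV"
    by auto
  have "((\<lambda>p. f (L p + c)) has_derivative (\<lambda>v. f' (L p + c) (L v))) (at p within S)" for p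
  proof -
    have "((\<lambda>p. L p + c) has_derivative L) (at p within S)"
      using has_derivative_add[OF bounded_linear_imp_has_derivative[OF assms(1)]
          has_derivative_const[of c]] by simp
    then show ?thesis
      using has_derivative_compose[OF _ f'(1)] by blast
  qed
  with Suc.IH[OF f'(2)] show ?case
    by (auto intro!: exI[of _ "\<lambda>p v. f' (L p + c) (L v)"])
qed

lemma smooth_on_cong:
  assumes "smooth_on S f" "\<And>x. x \<in> S \<Longrightarrow> f x = g x"
  shows "smooth_on S g"
  using assms Ck_on_cong[of S f g] unfolding smooth_on_def by blast

lemma smooth_on_const: "smooth_on S (\<lambda>x. c)"
  by (simp add: smooth_on_def Ck_on_const)

lemma smooth_on_add: "smooth_on S f \<Longrightarrow> smooth_on S g \<Longrightarrow> smooth_on S (\<lambda>x. f x + g x)"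
  by (simp add: smooth_on_def Ck_on_add)

lemma smooth_on_cmult: "smooth_on S f \<Longrightarrow> smooth_on S (\<lambda>x. c * f x)"
  by (simp add: smooth_on_def Ck_on_cmult)

lemma smooth_on_affine:
  "bounded_linear L \<Longrightarrow> smooth_on UNIV f \<Longrightarrow> smooth_on S (\<lambda>p. f (L p + c))"
  by (simp add: smooth_on_def Ck_on_affine)

lemma smooth_on_imp_continuous_on: "smooth_on S f \<Longrightarrow> continuous_on S f"
  unfolding smooth_on_def by (metis Ck_on.simps(1))

section \<open>Derivatives and antiderivatives of smooth functions on the line\<close>

text \<open>The derivative witnesses in \<open>Ck_on\<close> may change with the order; uniqueness
  of derivatives identifies them all with \<open>deriv g\<close>, which is therefore of every class
  at once.\<close>

lemma smooth_on_UNIV_deriv: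
  fixes g :: "real \<Rightarrow> real"
  assumes "smooth_on UNIV g"
  obtains g' where "\<And>x. (g has_real_derivative g' x) (at x)" "smooth_on UNIV g'"
proof -
  have *: "Ck_on n (deriv g) UNIV \<and> (\<forall>x. (g has_real_derivative deriv g x) (at x))" for n
  proof -
    obtain f' where f': "\<And>x. (g has_derivative f' x) (at x)" "\<And>v. Ck_on n (\<lambda>x. f' x v) UNIV"
      using assms unfolding smooth_on_def by (metis Ck_on.simps(2) UNIV_I)
    have "f' x = (*) (f' x 1)" for x
    proof
      fix v
      have "f' x (v *\<^sub>R 1) = v *\<^sub>R f' x 1"
        by (intro linear_cmul bounded_linear.linear has_derivative_bounded_linear[OF f'(1)])
      then show "f' x v = f' x 1 * v" by simp
    qed
    then have d: "(g has_real_derivative f' x 1) (at x)" for x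
      using f'(1)[of x] unfolding has_field_derivative_def by simp
    then have "deriv g = (\<lambda>x. f' x 1)" using DERIV_imp_deriv by blast
    then show ?thesis using f'(2)[of 1] d by simp
  qed
  then show ?thesis using that[of "deriv g"] unfolding smooth_on_def by blast
qed

lemma smooth_on_UNIV_antideriv:
  fixes g :: "real \<Rightarrow> real"
  assumes "\<And>x. (g has_real_derivative g' x) (at x)" "smooth_on UNIV g'"
  shows "smooth_on UNIV g"
  unfolding smooth_on_def
proof
  fix n
  show "Ck_on n g UNIV"
  proof (cases n)
    case 0
    then show ?thesis
      using DERIV_continuous_on[of UNIV g g'] assms(1) by simp
  next
    case (Suc k)
    have "Ck_on k (\<lambda>x. g' x * v) UNIV" for v
      using assms(2) Ck_on_cmult[of k g' UNIV v] by (simp add: smooth_on_def mult.commute)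
    then show ?thesis
      using assms(1) Suc by (auto simp: has_field_derivative_def intro!: exI[of _ "\<lambda>x v. g' x * v"])
  qed
qed

lemma antideriv_UNIV:
  fixes f :: "real \<Rightarrow> real"
  assumes "continuous_on UNIV f"
  obtains F where "\<And>x. (F has_real_derivative f x) (at x)"
proof -
  have "\<exists>F. \<forall>x::real. (-\<infinity> < ereal x \<and> ereal x < \<infinity>) \<longrightarrow> (F has_vector_derivative f x) (at x)"
    using einterval_antiderivative[of "-\<infinity>" "\<infinity>" f] assms
    by (auto simp: continuous_on_eq_continuous_at)
  then show ?thesis using that by (auto simp: has_real_derivative_iff_has_vector_derivative)
qed

lemma deriv_periodic:
  fixes g :: "real \<Rightarrow> real"
  assumes d: "\<And>x. (g has_real_derivative g' x) (at x)" and per: "\<And>x. g (x + c) = g x"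
  shows "g' (x + c) = g' x"
proof -
  have "((\<lambda>x. g (x + c)) has_real_derivative g' (x + c)) (at x)"
    using d[of "x + c"] by (simp add: DERIV_shift)
  then show ?thesis using d[of x] DERIV_unique unfolding per by blast
qed

section \<open>Fourier series of smooth periodic functions\<close>

lemma integral_eq_FTC:
  fixes f F :: "real \<Rightarrow> real"
  assumes "a \<le> b" "\<And>x. (F has_real_derivative f x) (at x)"
  shows "integral {a..b} f = F b - F a"
  using assms
  by (intro integral_unique fundamental_theorem_of_calculus)
    (auto simp: has_real_derivative_iff_has_vector_derivative[symmetric] intro: DERIV_subset)

text \<open>With an antiderivative F the shifted integral is F (pi + c) - F (- pi + c); its
  derivative in \<open>c\<close> is f (pi + c) - f (- pi + c), which periodicity makes zero.\<close>

lemma integral_periodic_shift: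
  fixes f :: "real \<Rightarrow> real"
  assumes cont: "continuous_on UNIV f" and per: "\<And>x. f (x + 2 * pi) = f x"
  shows "integral {-pi..pi} (\<lambda>x. f (x + c)) = integral {-pi..pi} f"
proof -
  obtain F where F: "\<And>x. (F has_real_derivative f x) (at x)"
    using antideriv_UNIV[OF cont] by blast
  have 1: "integral {-pi..pi} (\<lambda>x. f (x + c)) = F (pi + c) - F (-pi + c)"
    using F by (intro integral_eq_FTC) (simp_all add: DERIV_shift[symmetric])
  have "((\<lambda>c. F (pi + c) - F (-pi + c)) has_real_derivative 0) (at c)" for c
  proof -
    have "f (pi + c) = f (-pi + c)" using per[of "-pi + c"] by (simp add: algebra_simps)
    then show ?thesis by (auto intro!: derivative_eq_intros DERIV_chain'[OF _ F])
  qed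
  then have "F (pi + c) - F (-pi + c) = F (pi + 0) - F (-pi + 0)"
    using DERIV_isconst_all[of "\<lambda>c. F (pi + c) - F (-pi + c)"] by blast
  then show ?thesis using 1 integral_eq_FTC[OF _ F, of "-pi" pi] by simp
qed

lemma integral_odd:
  fixes f :: "real \<Rightarrow> real"
  assumes "\<And>x. x \<in> {-pi..pi} \<Longrightarrow> f (-x) = - f x"
  shows "integral {-pi..pi} f = 0"
proof -
  have "integral {-pi..pi} f = integral {-pi..pi} (\<lambda>x. f (-x))"
    using Henstock_Kurzweil_Integration.integral_reflect_real[of pi "-pi" f] by simp
  also have "\<dots> = integral {-pi..pi} (\<lambda>x. - f x)"
    by (intro integral_cong) (use assms in auto)
  finally show ?thesis by simp
qed

text \<open>The hypothesis says that the real number \<open>k\<close> is an integer, possibly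
  negative, as happens for differences of frequencies.\<close>

lemma integral_cos_int:
  assumes "sin (k * pi) = 0"
  shows "integral {-pi..pi} (\<lambda>y. cos (k * y)) = (if k = 0 then 2 * pi else 0)"
proof (cases "k = 0")
  case False
  have "integral {-pi..pi} (\<lambda>y. cos (k * y)) = sin (k * pi) / k - sin (k * (-pi)) / k"
    using False by (intro integral_eq_FTC[where F = "\<lambda>y. sin (k * y) / k"])
      (auto intro!: derivative_eq_intros)
  then show ?thesis using assms False by simp
qed simp

section \<open>Sine coefficients at half-integer frequencies\<close>

text \<open>The product formula turns two half-integer frequencies into the integers M - N and M + N
  + 1, and the second is never zero.\<close>

lemma sin_half_orthogonal:
  fixes M N :: nat
  shows "integral {-pi..pi} (\<lambda>y. sin ((real M + 1/2) * y) * sin ((real N + 1/2) * y))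
    = (if M = N then pi else 0)"
proof -
  let ?k = "real M - real N" and ?l = "real (M + N + 1)"
  have s: "sin (?k * pi) = 0" "sin (?l * pi) = 0"
    unfolding sin_times_pi_eq_0 by simp_all
  have e: "sin ((real M + 1/2) * y) * sin ((real N + 1/2) * y)
      = cos (?k * y) / 2 - cos (?l * y) / 2" for y
    by (simp add: sin_times_sin diff_divide_distrib algebra_simps)
  have "integral {-pi..pi} (\<lambda>y. cos (?k * y) / 2 - cos (?l * y) / 2)
      = integral {-pi..pi} (\<lambda>y. cos (?k * y)) / 2 - integral {-pi..pi} (\<lambda>y. cos (?l * y)) / 2"
    by (subst integral_diff) (auto intro!: integrable_continuous_real continuous_intros)
  also have "\<dots> = (if M = N then pi else 0)"
    using integral_cos_int[OF s(1)] integral_cos_int[OF s(2)] by auto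
  finally show ?thesis by (simp add: e)
qed

text \<open>Bessel's inequality for the functions \<open>sin ((N + 1/2) y)\<close>, which are orthogonal on
  \<open>[-\<pi>,\<pi>]\<close>, replaces the Riemann--Lebesgue lemma.\<close>

lemma sin_half_coeff_tendsto_0:
  assumes q: "continuous_on {-pi..pi} q"
  shows "(\<lambda>N::nat. integral {-pi..pi} (\<lambda>y. q y * sin ((real N + 1/2) * y))) \<longlonglongrightarrow> 0"
proof -
  define s where "s N y = sin ((real N + 1/2) * y)" for N :: nat and y :: real
  define c where "c N = integral {-pi..pi} (\<lambda>y. q y * s N y)" for N
  have sc [continuous_intros]: "continuous_on {-pi..pi} (s N)" for N
    unfolding s_def by (intro continuous_intros)
  note qc [continuous_intros] = q
  have bessel: "(\<Sum>N<M. (c N)\<^sup>2) \<le> pi * integral {-pi..pi} (\<lambda>y. (q y)\<^sup>2)" for M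
  proof -
    \<comment> \<open>The orthogonal projection of \<open>q\<close> onto the first \<open>M\<close>
      functions, each of squared norm \<open>pi\<close>. Bessel's inequality is the nonnegativity of
      the squared distance from \<open>q\<close> to it.\<close>
    let ?p = "\<lambda>y. \<Sum>N<M. c N / pi * s N y"
    have 1: "integral {-pi..pi} (\<lambda>y. q y * ?p y) = (\<Sum>N<M. (c N)\<^sup>2) / pi"
    proof -
      have "integral {-pi..pi} (\<lambda>y. q y * ?p y)
          = integral {-pi..pi} (\<lambda>y. \<Sum>N<M. c N / pi * (q y * s N y))"
        by (simp add: sum_distrib_left mult_ac)
      also have "\<dots> = (\<Sum>N<M. integral {-pi..pi} (\<lambda>y. c N / pi * (q y * s N y)))"
        by (intro integral_sum integrable_continuous_real continuous_intros) auto
      also have "\<dots> = (\<Sum>N<M. (c N)\<^sup>2 / pi)"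
        by (simp add: c_def[symmetric] power2_eq_square)
      finally show ?thesis by (simp add: sum_divide_distrib)
    qed
    have 2: "integral {-pi..pi} (\<lambda>y. (?p y)\<^sup>2) = (\<Sum>N<M. (c N)\<^sup>2) / pi"
    proof -
      have "integral {-pi..pi} (\<lambda>y. (?p y)\<^sup>2)
          = integral {-pi..pi} (\<lambda>y. \<Sum>N<M. \<Sum>K<M. c N * c K / pi\<^sup>2 * (s N y * s K y))"
        by (simp add: power2_eq_square sum_product mult_ac)
      also have "\<dots> = (\<Sum>N<M. integral {-pi..pi} (\<lambda>y. \<Sum>K<M. c N * c K / pi\<^sup>2 * (s N y * s K y)))"
        by (intro integral_sum integrable_continuous_real continuous_intros) auto
      also have "\<dots> = (\<Sum>N<M. \<Sum>K<M. integral {-pi..pi} (\<lambda>y. c N * c K / pi\<^sup>2 * (s N y * s K y)))"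
        by (intro sum.cong refl integral_sum integrable_continuous_real continuous_intros) auto
      also have "\<dots> = (\<Sum>N<M. \<Sum>K<M. if N = K then c N * c K / pi else 0)"
        by (intro sum.cong refl)
          (simp add: sin_half_orthogonal[folded s_def] power2_eq_square)
      also have "\<dots> = (\<Sum>N<M. (c N)\<^sup>2 / pi)"
        by (simp add: power2_eq_square)
      finally show ?thesis by (simp add: sum_divide_distrib)
    qed
    have "0 \<le> integral {-pi..pi} (\<lambda>y. (q y - ?p y)\<^sup>2)"
      by (intro integral_nonneg integrable_continuous_real continuous_intros) auto
    also have "\<dots> = integral {-pi..pi} (\<lambda>y. (q y)\<^sup>2 - 2 * (q y * ?p y) + (?p y)\<^sup>2)"
      by (intro integral_cong) (simp add: power2_diff)
    also have "\<dots> = integral {-pi..pi} (\<lambda>y. (q y)\<^sup>2)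
        - 2 * integral {-pi..pi} (\<lambda>y. q y * ?p y) + integral {-pi..pi} (\<lambda>y. (?p y)\<^sup>2)"
      by (subst integral_add integral_diff;
          (intro integrable_continuous_real continuous_intros)?; simp)+
    finally show ?thesis unfolding 1 2 by (simp add: field_simps)
  qed
  have "summable (\<lambda>N. (c N)\<^sup>2)"
    by (rule summableI_nonneg_bounded[OF _ bessel]) simp
  then have "(\<lambda>N. (c N)\<^sup>2) \<longlonglongrightarrow> 0" by (rule summable_LIMSEQ_zero)
  then have "(\<lambda>N. \<bar>c N\<bar>) \<longlonglongrightarrow> 0"
    using tendsto_real_sqrt[of "\<lambda>N. (c N)\<^sup>2" 0] by simp
  then show ?thesis
    using tendsto_rabs_zero_iff[of c] unfolding c_def s_def by blast
qed

section \<open>The Dirichlet kernel and pointwise convergence\<close>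

definition dirichlet_kernel :: "nat \<Rightarrow> real \<Rightarrow> real" where
  "dirichlet_kernel N y = 1 + 2 * (\<Sum>i<N. cos (real (Suc i) * y))"

text \<open>Telescoping of 2 sin (y/2) cos (k y) = sin ((k + 1/2) y) - sin ((k - 1/2) y). As a
  product rather than a quotient it needs no exception at the zeros of sin (y/2).\<close>

lemma dirichlet_kernel_sin:
  "sin (y / 2) * dirichlet_kernel N y = sin ((real N + 1/2) * y)"
proof (induction N)
  case (Suc N)
  have "2 * (sin (y / 2) * cos (real (Suc N) * y))
      = sin (real (Suc N) * y + y / 2) - sin (real (Suc N) * y - y / 2)"
    by (simp add: sin_add sin_diff)
  also have "real (Suc N) * y + y / 2 = (real (Suc N) + 1/2) * y"
    by (simp add: algebra_simps)
  also have "real (Suc N) * y - y / 2 = (real N + 1/2) * y"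
    by (simp add: algebra_simps)
  finally have "2 * (sin (y / 2) * cos (real (Suc N) * y))
      = sin ((real (Suc N) + 1/2) * y) - sin ((real N + 1/2) * y)" .
  with Suc show ?case by (simp add: dirichlet_kernel_def algebra_simps)
qed (simp add: dirichlet_kernel_def)

lemma continuous_on_dirichlet_kernel [continuous_intros]:
  fixes f :: "real \<Rightarrow> real"
  shows "continuous_on S f \<Longrightarrow> continuous_on S (\<lambda>y. dirichlet_kernel N (f y))"
  unfolding dirichlet_kernel_def by (intro continuous_intros)

lemma cos_nat_periodic: "cos (real m * (x + 2 * pi)) = cos (real m * x)"
  and sin_nat_periodic: "sin (real m * (x + 2 * pi)) = sin (real m * x)"
proof -
  have *: "real m * (x + 2 * pi) = real m * x + real m * (2 * pi)" by (simp add: algebra_simps)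
  have **: "cos (real m * (2 * pi)) = 1" "sin (real m * (2 * pi)) = 0"
    using cos_2npi[of m] sin_2npi[of m] by (simp_all add: mult_ac)
  show "cos (real m * (x + 2 * pi)) = cos (real m * x)"
    "sin (real m * (x + 2 * pi)) = sin (real m * x)"
    unfolding * cos_add sin_add ** by simp_all
qed

lemma integral_dirichlet_kernel: "integral {-pi..pi} (dirichlet_kernel N) = 2 * pi"
proof -
  have "integral {-pi..pi} (\<lambda>y. cos (real (Suc i) * y)) = 0" for i
    using integral_cos_int[of "real (Suc i)"] sin_npi[of "Suc i"] by simp
  moreover have "integral {-pi..pi} (dirichlet_kernel N)
      = integral {-pi..pi} (\<lambda>y. 1) + 2 * integral {-pi..pi} (\<lambda>y. \<Sum>i<N. cos (real (Suc i) * y))"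
    unfolding dirichlet_kernel_def
    by (subst integral_add) (auto intro!: integrable_continuous_real continuous_intros)
  moreover have "integral {-pi..pi} (\<lambda>y. \<Sum>i<N. cos (real (Suc i) * y))
      = (\<Sum>i<N. integral {-pi..pi} (\<lambda>y. cos (real (Suc i) * y)))"
    by (intro integral_sum integrable_continuous_real continuous_intros) auto
  ultimately show ?thesis by simp
qed

text \<open>The addition formula merges each pair of terms into an integral against cos (m (y - x));
  these sum to the kernel at y - x, and the shift by \<open>x\<close> is free by periodicity. The
  factor 2 reflects coefficients normalised by 1/(2 pi) for every \<open>m\<close>.\<close>

lemma fourier_partial_sum:
  fixes g :: "real \<Rightarrow> real"
  assumes g [continuous_intros]: "\<And>S. continuous_on S g" and per: "\<And>x. g (x + 2 * pi) = g x"
  shows "fourier_cos g 0 + 2 * (\<Sum>i<N. fourier_cos g (Suc i) * cos (real (Suc i) * x)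
      + fourier_sin g (Suc i) * sin (real (Suc i) * x))
    = 1 / (2 * pi) * integral {-pi..pi} (\<lambda>y. g (y + x) * dirichlet_kernel N y)"
proof -
  let ?I = "integral {-pi..pi}"
  have coeff: "fourier_cos g m * cos (real m * x) + fourier_sin g m * sin (real m * x)
      = 1 / (2 * pi) * ?I (\<lambda>y. g y * cos (real m * (y - x)))" for m
  proof -
    have "?I (\<lambda>y. g y * cos (real m * (y - x)))
        = ?I (\<lambda>y. cos (real m * x) * (g y * cos (real m * y)) + sin (real m * x) * (g y * sin (real m * y)))"
      by (intro integral_cong) (simp add: right_diff_distrib cos_diff algebra_simps)
    also have "\<dots> = cos (real m * x) * ?I (\<lambda>y. g y * cos (real m * y))
        + sin (real m * x) * ?I (\<lambda>y. g y * sin (real m * y))"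
      by (subst integral_add) (auto intro!: integrable_continuous_real continuous_intros)
    finally show ?thesis by (simp add: fourier_cos_def fourier_sin_def field_simps)
  qed
  have "?I (\<lambda>y. g (y + x) * dirichlet_kernel N y)
      = ?I (\<lambda>y. (\<lambda>z. g z * dirichlet_kernel N (z - x)) (y + x))" by simp
  also have "\<dots> = ?I (\<lambda>y. g y * dirichlet_kernel N (y - x))"
  proof (rule integral_periodic_shift)
    show "continuous_on UNIV (\<lambda>z. g z * dirichlet_kernel N (z - x))" by (intro continuous_intros)
    show "g (y + 2 * pi) * dirichlet_kernel N (y + 2 * pi - x) = g y * dirichlet_kernel N (y - x)" for y
      using cos_nat_periodic[of _ "y - x"] per[of y]
      by (simp add: dirichlet_kernel_def add_diff_eq[symmetric] add.commute[of _ "2 * pi"]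
          del: of_nat_Suc)
  qed
  also have "\<dots> = ?I (\<lambda>y. g y + (\<Sum>i<N. 2 * (g y * cos (real (Suc i) * (y - x)))))"
    by (simp add: dirichlet_kernel_def distrib_left sum_distrib_left mult_ac)
  also have "\<dots> = ?I g + ?I (\<lambda>y. \<Sum>i<N. 2 * (g y * cos (real (Suc i) * (y - x))))"
    by (intro integral_add integrable_continuous_real continuous_intros)
  also have "?I (\<lambda>y. \<Sum>i<N. 2 * (g y * cos (real (Suc i) * (y - x))))
      = (\<Sum>i<N. ?I (\<lambda>y. 2 * (g y * cos (real (Suc i) * (y - x)))))"
    by (intro integral_sum integrable_continuous_real continuous_intros) auto
  also have "\<dots> = (\<Sum>i<N. 2 * ?I (\<lambda>y. g y * cos (real (Suc i) * (y - x))))"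
    by simp
  finally show ?thesis
    unfolding coeff by (simp add: fourier_cos_def distrib_left sum_distrib_left mult_ac)
qed

text \<open>Since the kernel has integral 2 pi, the error is an average of g (y + x) - g x against
  it. Dividing that difference by sin (y/2) leaves a continuous function, because \<open>g\<close>
  is differentiable at \<open>x\<close>, and turns the error into a half-integer sine coefficient,
  which tends to zero.\<close>

lemma fourier_pointwise:
  fixes g :: "real \<Rightarrow> real"
  assumes d: "\<And>x. (g has_real_derivative g' x) (at x)" and per: "\<And>x. g (x + 2 * pi) = g x"
  shows "(\<lambda>N. fourier_cos g 0 + 2 * (\<Sum>i<N. fourier_cos g (Suc i) * cos (real (Suc i) * x)
      + fourier_sin g (Suc i) * sin (real (Suc i) * x))) \<longlonglongrightarrow> g x"
proof -
  have g: "continuous_on S g" for S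
    using d DERIV_continuous_on[of S g g'] by (auto intro: DERIV_subset)
  have gc [continuous_intros]: "continuous_on S (\<lambda>y. g (y + x))" for S
    by (rule continuous_on_compose2[OF g[of UNIV]]) (auto intro!: continuous_intros)
  \<comment> \<open>The value at zero is the limit: the difference quotient of \<open>g\<close>
    tends to \<open>g' x\<close> and sin (y/2) / y tends to 1/2.\<close>
  define q where "q y = (if y = 0 then 2 * g' x else (g (y + x) - g x) / sin (y / 2))" for y
  have nz: "sin (y / 2) \<noteq> 0" if "y \<in> {-pi..pi}" "y \<noteq> 0" for y
    using that sin_gt_zero[of "y / 2"] sin_gt_zero[of "- y / 2"] by (cases "y > 0") auto
  have "continuous_on {-pi..pi} q"
  proof (unfold continuous_on_eq_continuous_within, intro ballI)
    fix y assume y: "y \<in> {-pi..pi}"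
    show "continuous (at y within {-pi..pi}) q"
    proof (cases "y = 0")
      case True
      have l1: "((\<lambda>h. (g (x + h) - g x) / h) \<longlongrightarrow> g' x) (at 0)"
        using d[of x] by (simp add: DERIV_def)
      have "((\<lambda>h::real. sin (h / 2)) has_real_derivative 1 / 2) (at 0)"
        by (auto intro!: derivative_eq_intros)
      then have l2: "((\<lambda>h::real. sin (h / 2) / h) \<longlongrightarrow> 1 / 2) (at 0)"
        by (simp add: DERIV_def)
      have "((\<lambda>h. ((g (x + h) - g x) / h) / (sin (h / 2) / h)) \<longlongrightarrow> g' x / (1 / 2)) (at 0)"
        by (intro tendsto_divide l1 l2) simp
      moreover have "\<forall>\<^sub>F h in at 0. ((g (x + h) - g x) / h) / (sin (h / 2) / h) = q h"
        unfolding eventually_at_filter by (rule always_eventually) (auto simp: q_def add.commute)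
      ultimately have "(q \<longlongrightarrow> g' x / (1 / 2)) (at 0)"
        by (rule Lim_transform_eventually)
      then have "(q \<longlongrightarrow> q 0) (at 0)" by (simp add: q_def mult.commute)
      then show ?thesis
        unfolding True continuous_within by (rule tendsto_within_subset) simp
    next
      case False
      have gy: "isCont (\<lambda>y. g (y + x)) y"
        using gc[of UNIV] by (simp add: continuous_on_eq_continuous_at)
      have "isCont (\<lambda>y. (g (y + x) - g x) / sin (y / 2)) y"
        using nz[OF y False] by (intro continuous_intros gy) auto
      moreover have "\<forall>\<^sub>F z in nhds y. (g (z + x) - g x) / sin (z / 2) = q z"
        by (rule eventually_mono[OF t1_space_nhds[OF False]]) (simp add: q_def)
      ultimately have "isCont q y"
        using isCont_cong[of "\<lambda>y. (g (y + x) - g x) / sin (y / 2)" q y] by blast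
      then show ?thesis by (rule continuous_at_imp_continuous_at_within)
    qed
  qed
  then have lim: "(\<lambda>N. integral {-pi..pi} (\<lambda>y. q y * sin ((real N + 1/2) * y))) \<longlonglongrightarrow> 0"
    by (rule sin_half_coeff_tendsto_0)
  have "integral {-pi..pi} (\<lambda>y. q y * sin ((real N + 1/2) * y))
      = integral {-pi..pi} (\<lambda>y. g (y + x) * dirichlet_kernel N y) - 2 * pi * g x" for N
  proof -
    have "integral {-pi..pi} (\<lambda>y. q y * sin ((real N + 1/2) * y))
        = integral {-pi..pi} (\<lambda>y. g (y + x) * dirichlet_kernel N y - g x * dirichlet_kernel N y)"
    proof (rule integral_cong)
      fix y assume "y \<in> {-pi..pi}"
      then show "q y * sin ((real N + 1/2) * y)
          = g (y + x) * dirichlet_kernel N y - g x * dirichlet_kernel N y"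
        using nz[of y] unfolding dirichlet_kernel_sin[symmetric] left_diff_distrib[symmetric]
        by (cases "y = 0") (simp_all add: q_def)
    qed
    also have "\<dots> = integral {-pi..pi} (\<lambda>y. g (y + x) * dirichlet_kernel N y)
        - g x * integral {-pi..pi} (dirichlet_kernel N)"
      by (subst integral_diff) (auto intro!: integrable_continuous_real continuous_intros)
    finally show ?thesis by (simp add: integral_dirichlet_kernel)
  qed
  then have "(\<lambda>N. g x + 1 / (2 * pi) * (integral {-pi..pi} (\<lambda>y. g (y + x) * dirichlet_kernel N y)
      - 2 * pi * g x)) \<longlonglongrightarrow> g x + 1 / (2 * pi) * 0"
    using lim by (intro tendsto_intros) simp
  then show ?thesis
    unfolding fourier_partial_sum[OF g per] by (simp add: algebra_simps)
qed

section \<open>Decay of coefficients and unordered summation\<close>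

text \<open>The boundary terms vanish for different reasons: with the sine because sin (m pi) = 0,
  with the cosine because \<open>g\<close> agrees at the two ends.\<close>

lemma fourier_by_parts:
  fixes g :: "real \<Rightarrow> real"
  assumes d: "\<And>x. (g has_real_derivative g' x) (at x)" and c: "\<And>S. continuous_on S g'"
    and per: "\<And>x. g (x + 2 * pi) = g x" and m: "m > 0"
  shows "fourier_cos g m = - fourier_sin g' m / real m" "fourier_sin g m = fourier_cos g' m / real m"
proof -
  note [continuous_intros] = c
  have [continuous_intros]: "continuous_on S g" for S
    using d DERIV_continuous_on[of S g g'] by (auto intro: DERIV_subset)
  have p: "g pi = g (- pi)" using per[of "-pi"] by simp
  let ?I = "integral {-pi..pi}"
  have "?I (\<lambda>x. g' x * sin (real m * x) + g x * (cos (real m * x) * real m))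
      = g pi * sin (real m * pi) - g (-pi) * sin (real m * (-pi))"
    by (rule integral_eq_FTC) (auto intro!: derivative_eq_intros d simp: mult_ac)
  then have "?I (\<lambda>x. g' x * sin (real m * x)) + ?I (\<lambda>x. real m * (g x * cos (real m * x))) = 0"
    by (subst integral_add[symmetric])
      (auto intro!: integrable_continuous_real continuous_intros simp: mult_ac sin_npi2)
  then show "fourier_cos g m = - fourier_sin g' m / real m"
    using m by (simp add: fourier_cos_def fourier_sin_def field_simps)
  have "?I (\<lambda>x. g' x * cos (real m * x) + g x * (- sin (real m * x) * real m))
      = g pi * cos (real m * pi) - g (-pi) * cos (real m * (-pi))"
    by (rule integral_eq_FTC) (auto intro!: derivative_eq_intros d simp: mult_ac)
  then have "?I (\<lambda>x. g' x * cos (real m * x)) - ?I (\<lambda>x. real m * (g x * sin (real m * x))) = 0"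
    by (subst integral_diff[symmetric])
      (auto intro!: integrable_continuous_real continuous_intros simp: mult_ac p)
  then show "fourier_sin g m = fourier_cos g' m / real m"
    using m by (simp add: fourier_cos_def fourier_sin_def field_simps)
qed

lemma fourier_bounded:
  fixes g :: "real \<Rightarrow> real"
  assumes "continuous_on {-pi..pi} g"
  shows "\<exists>B. \<forall>m. \<bar>fourier_cos g m\<bar> \<le> B \<and> \<bar>fourier_sin g m\<bar> \<le> B"
proof -
  note [continuous_intros] = assms
  obtain K where K: "\<And>x. x \<in> {-pi..pi} \<Longrightarrow> \<bar>g x\<bar> \<le> K"
    using compact_imp_bounded[OF compact_continuous_image[OF assms]]
    unfolding bounded_iff by fastforce
  have b: "\<bar>g x * c\<bar> \<le> K" if "x \<in> {-pi..pi}" "\<bar>c\<bar> \<le> 1" for x c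
    using mult_mono[OF K[OF that(1)] that(2)] K[OF that(1)] by (auto simp: abs_mult)
  have 1: "norm (integral {-pi..pi} (\<lambda>x. g x * cos (real m * x))) \<le> K * (pi - (-pi))" for m
    by (rule integral_bound) (auto intro!: continuous_intros b)
  have 2: "norm (integral {-pi..pi} (\<lambda>x. g x * sin (real m * x))) \<le> K * (pi - (-pi))" for m
    by (rule integral_bound) (auto intro!: continuous_intros b)
  have "\<bar>fourier_cos g m\<bar> \<le> K \<and> \<bar>fourier_sin g m\<bar> \<le> K" for m
    using 1[of m] 2[of m]
    by (simp add: fourier_cos_def fourier_sin_def abs_mult field_simps)
  then show ?thesis by blast
qed

text \<open>Two integrations by parts lead to the bounded coefficients of the second derivative. The
  rate 1/m^2 yields absolute summability, so that unordered sums are legitimate.\<close>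

lemma fourier_decay:
  assumes "smooth_on UNIV g" and per: "\<And>x. g (x + 2 * pi) = g x"
  shows "\<exists>B. \<forall>m>0. \<bar>fourier_cos g m\<bar> \<le> B / (real m)\<^sup>2 \<and> \<bar>fourier_sin g m\<bar> \<le> B / (real m)\<^sup>2"
proof -
  obtain g' where g': "\<And>x. (g has_real_derivative g' x) (at x)" "smooth_on UNIV g'"
    using smooth_on_UNIV_deriv[OF assms(1)] by blast
  obtain g'' where g'': "\<And>x. (g' has_real_derivative g'' x) (at x)" "smooth_on UNIV g''"
    using smooth_on_UNIV_deriv[OF g'(2)] by blast
  have c: "continuous_on S g'" "continuous_on S g''" for S
    using smooth_on_imp_continuous_on[OF g'(2)] smooth_on_imp_continuous_on[OF g''(2)]
    by (auto elim: continuous_on_subset)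
  obtain B where B: "\<And>m. \<bar>fourier_cos g'' m\<bar> \<le> B" "\<And>m. \<bar>fourier_sin g'' m\<bar> \<le> B"
    using fourier_bounded[OF c(2)] by blast
  have "\<bar>fourier_cos g m\<bar> \<le> B / (real m)\<^sup>2 \<and> \<bar>fourier_sin g m\<bar> \<le> B / (real m)\<^sup>2"
    if m: "m > 0" for m
    using B[of m] fourier_by_parts[OF g'(1) c(1) per m]
      fourier_by_parts[OF g''(1) c(2) deriv_periodic[OF g'(1) per] m] m
    by (simp add: power2_eq_square divide_right_mono)
  then show ?thesis by blast
qed

lemma summable_on_inverse_square_bound:
  fixes f :: "nat \<Rightarrow> real"
  assumes "\<And>m. m > 0 \<Longrightarrow> \<bar>f m\<bar> \<le> B / (real m)\<^sup>2"
  shows "f summable_on {1..}"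
proof -
  have "summable (\<lambda>m. B * inverse ((real m)\<^sup>2))"
    by (intro summable_mult inverse_power_summable) simp
  then have "summable (\<lambda>m. norm (f m))"
    by (rule summable_comparison_test_ev[rotated])
      (use assms in \<open>auto simp: eventually_at_top_linorder field_simps intro!: exI[of _ 1]\<close>)
  then show ?thesis
    using norm_summable_imp_summable_on summable_on_subset_banach by blast
qed

text \<open>The bounded factors \<open>c\<close> and \<open>d\<close> stand for any combination of
  sines and cosines in \<open>x\<close> and \<open>t\<close>.\<close>

lemma fourier_summable:
  assumes "smooth_on UNIV g" "\<And>x. g (x + 2 * pi) = g x"
    and c: "\<And>m. \<bar>c m\<bar> \<le> 1" "\<And>m. \<bar>d m\<bar> \<le> 1"
  shows "(\<lambda>m. fourier_cos g m * c m * d m) summable_on {1..}"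
    "(\<lambda>m. fourier_sin g m * c m * d m) summable_on {1..}"
proof -
  obtain B where B: "\<And>m. m > 0 \<Longrightarrow> \<bar>fourier_cos g m\<bar> \<le> B / (real m)\<^sup>2"
    "\<And>m. m > 0 \<Longrightarrow> \<bar>fourier_sin g m\<bar> \<le> B / (real m)\<^sup>2"
    using fourier_decay[OF assms(1,2)] by blast
  have *: "\<bar>e * c m * d m\<bar> \<le> b" if "\<bar>e\<bar> \<le> b" for e b m
  proof -
    have "\<bar>e\<bar> * (\<bar>c m\<bar> * \<bar>d m\<bar>) \<le> b * 1"
      using that by (intro mult_mono mult_le_one c) auto
    then show ?thesis by (simp add: abs_mult mult.assoc)
  qed
  show "(\<lambda>m. fourier_cos g m * c m * d m) summable_on {1..}"
    by (rule summable_on_inverse_square_bound) (rule *[OF B(1)])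
  show "(\<lambda>m. fourier_sin g m * c m * d m) summable_on {1..}"
    by (rule summable_on_inverse_square_bound) (rule *[OF B(2)])
qed

text \<open>Decay provides some unordered sum \<open>s\<close>. It is also the limit of the ordered
  partial sums, which pointwise convergence identifies.\<close>

lemma fourier_has_sum:
  assumes sm: "smooth_on UNIV g" and per: "\<And>x. g (x + 2 * pi) = g x"
  shows "((\<lambda>m. fourier_cos g m * cos (real m * x) + fourier_sin g m * sin (real m * x))
    has_sum (g x - fourier_cos g 0) / 2) {1..}"
proof -
  let ?f = "\<lambda>m. fourier_cos g m * cos (real m * x) + fourier_sin g m * sin (real m * x)"
  obtain g' where g': "\<And>x. (g has_real_derivative g' x) (at x)"
    using smooth_on_UNIV_deriv[OF sm] by blast
  have "?f summable_on {1..}"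
    using fourier_summable[OF sm per, where d = "\<lambda>_. 1"]
    by (intro summable_on_add) simp_all
  then obtain s where s: "(?f has_sum s) {1..}" unfolding summable_on_def by blast
  have "(?f has_sum s) (range Suc)"
  proof -
    have "{1..} = range Suc" by (auto dest: Suc_le_D)
    with s show ?thesis by simp
  qed
  then have "((?f \<circ> Suc) has_sum s) UNIV"
    by (subst (asm) has_sum_reindex) auto
  then have "(\<lambda>N. \<Sum>i<N. ?f (Suc i)) \<longlonglongrightarrow> s"
    using has_sum_imp_sums[of "?f \<circ> Suc" s] by (simp add: sums_def)
  then have "(\<lambda>N. fourier_cos g 0 + 2 * (\<Sum>i<N. ?f (Suc i))) \<longlonglongrightarrow> fourier_cos g 0 + 2 * s"
    by (intro tendsto_intros)
  then have "g x = fourier_cos g 0 + 2 * s"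
    by (rule LIMSEQ_unique[OF fourier_pointwise[OF g' per]])
  with s show ?thesis by simp
qed

section \<open>From translates to separated variables\<close>

text \<open>In the sum of the series at x + t and x - t the addition formulas cancel every term
  containing sin (m t); the difference treated next keeps exactly those terms.\<close>

lemma fourier_even_translates:
  assumes sm: "smooth_on UNIV g" and per: "\<And>x. g (x + 2 * pi) = g x"
  shows "(g (x + t) + g (x - t)) / 2 = fourier_cos g 0
    + 2 * (\<Sum>\<^sub>\<infinity>m\<in>{1..}. fourier_cos g m * cos (real m * x) * cos (real m * t))
    + 2 * (\<Sum>\<^sub>\<infinity>m\<in>{1..}. fourier_sin g m * sin (real m * x) * cos (real m * t))"
    (is "_ = _ + 2 * infsum ?A _ + 2 * infsum ?B _")
proof -
  let ?f = "\<lambda>x m. fourier_cos g m * cos (real m * x) + fourier_sin g m * sin (real m * x)"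
  have "?A summable_on {1..}" "?B summable_on {1..}"
    by (rule fourier_summable[OF sm per]; simp)+
  then have 1: "((\<lambda>m. 2 * ?A m + 2 * ?B m) has_sum (2 * infsum ?A {1..} + 2 * infsum ?B {1..})) {1..}"
    by (intro has_sum_add has_sum_cmult_right has_sum_infsum)
  have 2: "((\<lambda>m. ?f (x + t) m + ?f (x - t) m) has_sum
      ((g (x + t) - fourier_cos g 0) / 2 + (g (x - t) - fourier_cos g 0) / 2)) {1..}"
    by (intro has_sum_add fourier_has_sum[OF sm per])
  have "(\<lambda>m. ?f (x + t) m + ?f (x - t) m) = (\<lambda>m. 2 * ?A m + 2 * ?B m)"
    by (simp add: distrib_left right_diff_distrib cos_add sin_add cos_diff sin_diff fun_eq_iff)
  with 1 2 have "2 * infsum ?A {1..} + 2 * infsum ?B {1..}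
      = (g (x + t) - fourier_cos g 0) / 2 + (g (x - t) - fourier_cos g 0) / 2"
    by (simp only: has_sum_unique)
  then show ?thesis by (simp add: field_simps)
qed

lemma fourier_odd_translates:
  assumes sm: "smooth_on UNIV g" and per: "\<And>x. g (x + 2 * pi) = g x"
  shows "(g (x + t) - g (x - t)) / 2 =
    2 * (\<Sum>\<^sub>\<infinity>m\<in>{1..}. fourier_sin g m * cos (real m * x) * sin (real m * t))
    - 2 * (\<Sum>\<^sub>\<infinity>m\<in>{1..}. fourier_cos g m * sin (real m * x) * sin (real m * t))"
    (is "_ = 2 * infsum ?A _ - 2 * infsum ?B _")
proof -
  let ?f = "\<lambda>x m. fourier_cos g m * cos (real m * x) + fourier_sin g m * sin (real m * x)"
  have "?A summable_on {1..}" "?B summable_on {1..}"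
    by (rule fourier_summable[OF sm per]; simp)+
  then have 1: "((\<lambda>m. 2 * ?A m + (- 2) * ?B m) has_sum (2 * infsum ?A {1..} + (- 2) * infsum ?B {1..})) {1..}"
    by (intro has_sum_add has_sum_cmult_right has_sum_infsum)
  have 2: "((\<lambda>m. ?f (x + t) m + (- 1) * ?f (x - t) m) has_sum
      ((g (x + t) - fourier_cos g 0) / 2 + (- 1) * ((g (x - t) - fourier_cos g 0) / 2))) {1..}"
    by (intro has_sum_add has_sum_cmult_right fourier_has_sum[OF sm per])
  have "(\<lambda>m. ?f (x + t) m + (- 1) * ?f (x - t) m) = (\<lambda>m. 2 * ?A m + (- 2) * ?B m)"
    by (simp add: distrib_left right_diff_distrib cos_add sin_add cos_diff sin_diff fun_eq_iff)
  with 1 2 have "2 * infsum ?A {1..} + (- 2) * infsum ?B {1..}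
      = (g (x + t) - fourier_cos g 0) / 2 + (- 1) * ((g (x - t) - fourier_cos g 0) / 2)"
    by (simp only: has_sum_unique)
  then show ?thesis by (simp add: field_simps)
qed

section \<open>Smooth solutions are travelling waves\<close>

text \<open>Two uses of the mean value theorem, one per variable. The left side is symmetric in the
  variables, so exchanging their roles expresses the same number by the other mixed
  derivative.\<close>

lemma second_difference:
  fixes f fx fxt :: "real \<Rightarrow> real \<Rightarrow> real"
  assumes h: "h > 0"
    and fx: "\<And>y s. y \<in> {x..x+h} \<Longrightarrow> s \<in> {t..t+h} \<Longrightarrow> ((\<lambda>y. f y s) has_real_derivative fx y s) (at y)"
    and fxt: "\<And>y s. y \<in> {x..x+h} \<Longrightarrow> s \<in> {t..t+h} \<Longrightarrow> (fx y has_real_derivative fxt y s) (at s)"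
  shows "\<exists>y\<in>{x..x+h}. \<exists>s\<in>{t..t+h}.
    f (x + h) (t + h) - f (x + h) t - f x (t + h) + f x t = h * (h * fxt y s)"
proof -
  have "\<exists>y. x < y \<and> y < x + h \<and> (f (x+h) (t+h) - f (x+h) t) - (f x (t+h) - f x t)
      = (x + h - x) * (fx y (t+h) - fx y t)"
    by (rule MVT2) (use h in \<open>auto intro!: DERIV_diff fx\<close>)
  then obtain y where y: "x < y" "y < x + h"
    "(f (x+h) (t+h) - f (x+h) t) - (f x (t+h) - f x t) = h * (fx y (t+h) - fx y t)" by auto
  have "\<exists>s. t < s \<and> s < t + h \<and> fx y (t + h) - fx y t = (t + h - t) * fxt y s"
    by (rule MVT2) (use h y in \<open>auto intro!: fxt\<close>)
  then obtain s where "t < s" "s < t + h" "fx y (t + h) - fx y t = h * fxt y s" by auto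
  with y show ?thesis by (intro bexI[of _ y] bexI[of _ s]) auto
qed

lemma derivative_along_line:
  fixes f :: "'a::real_normed_vector \<Rightarrow> real"
  assumes "(f has_derivative f') (at (p + s *\<^sub>R v))"
  shows "((\<lambda>s. f (p + s *\<^sub>R v)) has_real_derivative f' v) (at s)"
proof -
  have "((\<lambda>s. p + s *\<^sub>R v) has_derivative (\<lambda>s. s *\<^sub>R v)) (at s)"
    by (auto intro!: derivative_eq_intros)
  from has_derivative_compose[OF this assms]
  have "((\<lambda>s. f (p + s *\<^sub>R v)) has_derivative (\<lambda>s. f' (s *\<^sub>R v))) (at s)" .
  moreover have "(\<lambda>s. f' (s *\<^sub>R v)) = (*) (f' v)"
    using linear_cmul[OF bounded_linear.linear[OF has_derivative_bounded_linear[OF assms]]]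
    by (auto simp: mult.commute)
  ultimately show ?thesis by (simp add: has_field_derivative_def)
qed

lemma derivative_partial:
  fixes f :: "real \<times> real \<Rightarrow> real"
  assumes "(f has_derivative f') (at (x, t))"
  shows "((\<lambda>y. f (y, t)) has_real_derivative f' (1, 0)) (at x)"
    "((\<lambda>s. f (x, s)) has_real_derivative f' (0, 1)) (at t)"
  using derivative_along_line[of f f' "(0, t)" x "(1, 0)"]
    derivative_along_line[of f f' "(x, 0)" t "(0, 1)"] assms by simp_all

text \<open>If the values differed by 2e, continuity would keep each mixed derivative within e of
  its value on a small square, yet the second difference forces the two to coincide at some pair of
  points there.\<close>

lemma mixed_partials_eq:
  fixes f :: "real \<times> real \<Rightarrow> real"
  assumes "open S" and p: "(x, t) \<in> S"
    and f': "\<And>p. p \<in> S \<Longrightarrow> (f has_derivative f' p) (at p)"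
    and fx: "\<And>p. p \<in> S \<Longrightarrow> ((\<lambda>p. f' p (1, 0)) has_derivative fx p) (at p)"
    and ft: "\<And>p. p \<in> S \<Longrightarrow> ((\<lambda>p. f' p (0, 1)) has_derivative ft p) (at p)"
    and c: "continuous_on S (\<lambda>p. fx p (0, 1))" "continuous_on S (\<lambda>p. ft p (1, 0))"
  shows "fx (x, t) (0, 1) = ft (x, t) (1, 0)"
proof (rule ccontr)
  assume ne: "fx (x, t) (0, 1) \<noteq> ft (x, t) (1, 0)"
  define e where "e = \<bar>fx (x, t) (0, 1) - ft (x, t) (1, 0)\<bar> / 2"
  have e: "e > 0" using ne by (simp add: e_def)
  obtain d1 where d1: "d1 > 0" "ball (x, t) d1 \<subseteq> S"
    using assms(1) p open_contains_ball by blast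
  obtain d2 where d2: "d2 > 0"
    "\<And>p. p \<in> S \<Longrightarrow> dist p (x, t) < d2 \<Longrightarrow> dist (fx p (0, 1)) (fx (x, t) (0, 1)) < e"
    using c(1) p e unfolding continuous_on_iff by meson
  obtain d3 where d3: "d3 > 0"
    "\<And>p. p \<in> S \<Longrightarrow> dist p (x, t) < d3 \<Longrightarrow> dist (ft p (1, 0)) (ft (x, t) (1, 0)) < e"
    using c(2) p e unfolding continuous_on_iff by meson
  \<comment> \<open>Points of the square of side \<open>h\<close> are at distance at most 2h, hence
    less than 3h, from its corner.\<close>
  define h where "h = min d1 (min d2 d3) / 3"
  have h: "h > 0" "3 * h \<le> d1" "3 * h \<le> d2" "3 * h \<le> d3"
    using d1(1) d2(1) d3(1) by (auto simp: h_def)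
  have near: "dist (y, s) (x, t) < 3 * h" if "y \<in> {x..x+h}" "s \<in> {t..t+h}" for y s
  proof -
    have "dist (y, s) (x, t) \<le> \<bar>y - x\<bar> + \<bar>s - t\<bar>"
      unfolding dist_Pair_Pair dist_real_def by (rule order_trans[OF sqrt_sum_squares_le_sum_abs]) simp
    then show ?thesis using that h(1) by auto
  qed
  have inS: "(y, s) \<in> S" if "y \<in> {x..x+h}" "s \<in> {t..t+h}" for y s
    using near[OF that] d1(2) h(2) by (force simp: dist_commute)
  obtain y1 s1 where 1: "y1 \<in> {x..x+h}" "s1 \<in> {t..t+h}"
    "f (x + h, t + h) - f (x + h, t) - f (x, t + h) + f (x, t) = h * (h * fx (y1, s1) (0, 1))"
    using second_difference[OF h(1), of x t "\<lambda>y s. f (y, s)" "\<lambda>y s. f' (y, s) (1, 0)"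
        "\<lambda>y s. fx (y, s) (0, 1)"]
      derivative_partial(1)[OF f'[OF inS]] derivative_partial(2)[OF fx[OF inS]] by blast
  obtain y2 s2 where 2: "y2 \<in> {x..x+h}" "s2 \<in> {t..t+h}"
    "f (x + h, t + h) - f (x, t + h) - f (x + h, t) + f (x, t) = h * (h * ft (y2, s2) (1, 0))"
    using second_difference[OF h(1), of t x "\<lambda>s y. f (y, s)" "\<lambda>s y. f' (y, s) (0, 1)"
        "\<lambda>s y. ft (y, s) (1, 0)"]
      derivative_partial(2)[OF f'[OF inS]] derivative_partial(1)[OF ft[OF inS]] by blast
  have "h * (h * fx (y1, s1) (0, 1)) = h * (h * ft (y2, s2) (1, 0))"
    using 1(3) 2(3) by linarith
  then have "fx (y1, s1) (0, 1) = ft (y2, s2) (1, 0)" using h(1) by simp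
  moreover have "dist (fx (y1, s1) (0, 1)) (fx (x, t) (0, 1)) < e"
    using d2(2)[OF inS[OF 1(1,2)]] near[OF 1(1,2)] h(3) by linarith
  moreover have "dist (ft (y2, s2) (1, 0)) (ft (x, t) (1, 0)) < e"
    using d3(2)[OF inS[OF 2(1,2)]] near[OF 2(1,2)] h(4) by linarith
  ultimately show False unfolding dist_real_def e_def by (simp add: abs_if split: if_splits)
qed

lemma open_strip_interior: "open strip_interior"
  by (simp add: strip_interior_def open_Times)

section \<open>D'Alembert's form on the open strip\<close>

text \<open>Time is unbounded, so every characteristic through a point of the strip meets the line x
  = 0 inside it. The first derivatives on that line thus determine those on the whole strip, and
  integrating them recovers \<open>u\<close> up to a constant.\<close>

lemma smooth_wave_dalembert:
  assumes sm: "smooth_on strip_interior u" and wave: "wave_equation u"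
  obtains F G p q where
    "\<And>z. (F has_real_derivative p z) (at z)" "\<And>z. (G has_real_derivative q z) (at z)"
    "continuous_on UNIV p" "continuous_on UNIV q"
    "\<And>x t. (x, t) \<in> strip_interior \<Longrightarrow> u (x, t) = F (x + t) + G (x - t)"
proof -
  let ?S = strip_interior
  have mem: "(x, t) \<in> ?S \<longleftrightarrow> -pi < x \<and> x < pi" for x t
    by (auto simp: strip_interior_def)
  have "Ck_on (Suc (Suc 0)) u ?S" using sm unfolding smooth_on_def by blast
  then obtain u' where u'0: "\<And>p. p \<in> ?S \<Longrightarrow> (u has_derivative u' p) (at p within ?S)"
    and u'1: "\<And>v. Ck_on (Suc 0) (\<lambda>p. u' p v) ?S"
    unfolding Ck_on.simps by blast
  have u': "(u has_derivative u' p) (at p)" if "p \<in> ?S" for p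
    using u'0[OF that] at_within_open[OF that open_strip_interior] by simp
  \<comment> \<open>Class C2 supplies a derivative for each directional derivative of
    \<open>u\<close> separately; \<open>w v p v'\<close> collects the second derivatives in
    direction \<open>v\<close>, then \<open>v'\<close>.\<close>
  have "\<exists>w. (\<forall>p\<in>?S. ((\<lambda>p. u' p v) has_derivative w p) (at p)) \<and> (\<forall>v. continuous_on ?S (\<lambda>p. w p v))" for v
    using u'1[of v] at_within_open[OF _ open_strip_interior] unfolding Ck_on.simps by auto
  then obtain w where w: "\<And>v p. p \<in> ?S \<Longrightarrow> ((\<lambda>p. u' p v) has_derivative w v p) (at p)"
    and wc: "\<And>v v'. continuous_on ?S (\<lambda>p. w v p v')"
    by metis
  let ?ux = "\<lambda>p. u' p (1, 0)" and ?ut = "\<lambda>p. u' p (0, 1)"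
  have mixed: "w (1, 0) (x, t) (0, 1) = w (0, 1) (x, t) (1, 0)" if "(x, t) \<in> ?S" for x t
    by (rule mixed_partials_eq[OF open_strip_interior that u' w w wc wc])
  have eq: "w (0, 1) (x, t) (0, 1) = w (1, 0) (x, t) (1, 0)" if "(x, t) \<in> ?S" for x t
  proof -
    have S: "(x, s) \<in> ?S" for s using that by (simp add: mem)
    have "(\<lambda>s. deriv (\<lambda>r. u (x, r)) s) = (\<lambda>s. ?ut (x, s))"
      using DERIV_imp_deriv[OF derivative_partial(2)[OF u'[OF S]]] by blast
    then have 1: "deriv (\<lambda>s. deriv (\<lambda>r. u (x, r)) s) t = w (0, 1) (x, t) (0, 1)"
      using DERIV_imp_deriv[OF derivative_partial(2)[OF w[OF that, of "(0, 1)"]]] by simp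
    have "\<forall>\<^sub>F y in nhds x. y \<in> {-pi<..<pi}"
      using that by (intro eventually_nhds_in_open) (auto simp: mem)
    then have "\<forall>\<^sub>F y in nhds x. deriv (\<lambda>z. u (z, t)) y = ?ux (y, t)"
      by (rule eventually_mono)
        (auto intro!: DERIV_imp_deriv[OF derivative_partial(1)[OF u']] simp: mem)
    then have 2: "deriv (\<lambda>y. deriv (\<lambda>z. u (z, t)) y) x = w (1, 0) (x, t) (1, 0)"
      using DERIV_imp_deriv[OF derivative_partial(1)[OF w[OF that, of "(1, 0)"]]]
        deriv_cong_ev by metis
    have "deriv (\<lambda>s. deriv (\<lambda>r. u (x, r)) s) t - deriv (\<lambda>y. deriv (\<lambda>z. u (z, t)) y) x = 0"
      using wave that unfolding wave_equation_def by blast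
    with 1 2 show ?thesis by simp
  qed
  have lin: "w v p (a, b) = a * w v p (1, 0) + b * w v p (0, 1)" if "p \<in> ?S" for v p a b
  proof -
    interpret bounded_linear "w v p" using has_derivative_bounded_linear[OF w[OF that]] .
    have "w v p (a *\<^sub>R (1, 0) + b *\<^sub>R (0, 1)) = a * w v p (1, 0) + b * w v p (0, 1)"
      unfolding add scaleR by simp
    then show ?thesis by simp
  qed
  \<comment> \<open>By the wave equation and the symmetry of mixed partials, \<open>u\<^sub>t + k u\<^sub>x\<close> with \<open>k = \<plusminus>1\<close> is
    constant on the characteristics \<open>x + k t = const\<close>.\<close>
  have char: "?ut (x, t) + k * ?ux (x, t) = ?ut (0, t + k * x) + k * ?ux (0, t + k * x)"
    if S: "(x, t) \<in> ?S" and k: "k * k = 1" for x t k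
  proof -
    \<comment> \<open>Here \<open>y\<close> is the space coordinate along the characteristic:
      \<open>y = 0\<close> is its foot on the axis and \<open>y = x\<close> is the point (x,
      t).\<close>
    define c where "c y = ?ut ((0, t + k * x) + y *\<^sub>R (1, - k))
      + k * ?ux ((0, t + k * x) + y *\<^sub>R (1, - k))" for y
    have "(c has_real_derivative 0) (at y)" if y: "y \<in> {-pi<..<pi}" for y
    proof -
      let ?p = "(0, t + k * x) + y *\<^sub>R (1, - k)"
      have p: "?p \<in> ?S" using y by (simp add: mem)
      have "(c has_real_derivative w (0, 1) ?p (1, - k) + k * w (1, 0) ?p (1, - k)) (at y)"
        unfolding c_def by (intro DERIV_add DERIV_cmult derivative_along_line w p)
      moreover have "w (0, 1) ?p (1, - k) + k * w (1, 0) ?p (1, - k) = 0"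
      proof -
        have "w (1, 0) ?p (0, 1) = w (0, 1) ?p (1, 0)" "w (0, 1) ?p (0, 1) = w (1, 0) ?p (1, 0)"
          using mixed eq p by auto
        then have "w (0, 1) ?p (1, - k) + k * w (1, 0) ?p (1, - k)
            = (1 - k * k) * w (0, 1) ?p (1, 0)"
          unfolding lin[OF p, of _ 1 "- k"] by (simp add: algebra_simps)
        with k show ?thesis by simp
      qed
      ultimately show ?thesis by simp
    qed
    then have "c x = c 0"
      using DERIV_isconst3[of "-pi" pi x 0 c] S by (auto simp: mem)
    then show ?thesis using k by (simp add: c_def algebra_simps)
  qed
  have uc: "continuous_on ?S (\<lambda>p. u' p v)" for v
    by (rule has_derivative_continuous_on[where f' = "w v"])
      (rule has_derivative_at_withinI[OF w])
  have line: "continuous_on UNIV (\<lambda>z. u' (0, k * z) v)" for v and k :: real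
    by (rule continuous_on_compose2[OF uc]) (auto intro!: continuous_intros simp: mem)
  \<comment> \<open>Solves u_x = p + q, u_t = p - q on the line x = 0, where \<open>q\<close> has
    argument -t. The explicit factors \<open>1\<close> and \<open>(- 1)\<close> are instances of
    \<open>k\<close> in \<open>line\<close>.\<close>
  define p where "p z = (?ut (0, 1 * z) + ?ux (0, 1 * z)) / 2" for z
  define q where "q z = (?ux (0, (- 1) * z) - ?ut (0, (- 1) * z)) / 2" for z
  have pq: "continuous_on UNIV p" "continuous_on UNIV q"
    unfolding p_def q_def by (intro continuous_intros line; simp)+
  obtain F G where F: "\<And>z. (F has_real_derivative p z) (at z)"
    and G: "\<And>z. (G has_real_derivative q z) (at z)"
    using antideriv_UNIV[OF pq(1)] antideriv_UNIV[OF pq(2)] by metis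
  define d where "d x t = u (x, t) - (F (x + t) + G (x - t))" for x t
  have sys: "?ux (x, t) = p (x + t) + q (x - t)" "?ut (x, t) = p (x + t) - q (x - t)"
    if "(x, t) \<in> ?S" for x t
    using char[OF that, of 1] char[OF that, of "- 1"]
    by (auto simp: p_def q_def field_simps)
  have dx: "((\<lambda>x. d x t) has_real_derivative 0) (at x)" if "(x, t) \<in> ?S" for x t
    unfolding d_def using sys(1)[OF that]
    by (auto intro!: derivative_eq_intros DERIV_chain2[OF F] DERIV_chain2[OF G]
        derivative_partial(1)[OF u'[OF that]])
  have dt: "(d x has_real_derivative 0) (at t)" if "(x, t) \<in> ?S" for x t
    unfolding d_def using sys(2)[OF that]
    by (auto intro!: derivative_eq_intros DERIV_chain2[OF F] DERIV_chain2[OF G]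
        derivative_partial(2)[OF u'[OF that]])
  have d: "d x t = d 0 0" if "(x, t) \<in> ?S" for x t
  proof -
    have "d x t = d 0 t"
      using DERIV_isconst3[of "-pi" pi x 0 "\<lambda>x. d x t"] dx that by (auto simp: mem)
    also have "d 0 t = d 0 0"
      using DERIV_isconst_all[of "d 0"] dt by (auto simp: mem)
    finally show ?thesis .
  qed
  \<comment> \<open>The constant of integration is absorbed into the second profile.\<close>
  have G2: "((\<lambda>z. G z + d 0 0) has_real_derivative q z) (at z)" for z
    using DERIV_add[OF G DERIV_const] by simp
  show ?thesis
    by (rule that[OF F G2 pq]) (use d in \<open>auto simp: d_def algebra_simps\<close>)
qed

section \<open>Gluing at the end points and uniqueness\<close>

lemma eq_on_closed_interval:
  fixes f g :: "real \<Rightarrow> real"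
  assumes "continuous_on {a..b} f" "continuous_on {a..b} g" "a < b"
    and "\<And>x. x \<in> {a<..<b} \<Longrightarrow> f x = g x" and "x \<in> {a..b}"
  shows "f x = g x"
proof -
  have c: "closure {a<..<b} = {a..b}" using assms(3) by simp
  have "f x - g x = 0"
    by (rule continuous_constant_on_closure[of "{a<..<b}" "\<lambda>x. f x - g x"])
      (use assms in \<open>auto simp: c intro!: continuous_intros\<close>)
  then show ?thesis by simp
qed

lemma periodic_eq:
  fixes f g :: "real \<Rightarrow> real"
  assumes pf: "\<And>x. f (x + 2 * pi) = f x" and pg: "\<And>x. g (x + 2 * pi) = g x"
    and eq: "\<And>x. x \<in> {-pi..pi} \<Longrightarrow> f x = g x"
  shows "f x = g x"
proof -
  interpret f: periodic_fun_simple f "2 * pi" by standard (rule pf)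
  interpret g: periodic_fun_simple g "2 * pi" by standard (rule pg)
  let ?k = "\<lfloor>(x + pi) / (2 * pi)\<rfloor>"
  have "of_int ?k \<le> (x + pi) / (2 * pi)" "(x + pi) / (2 * pi) < of_int ?k + 1"
    by linarith+
  then have "of_int ?k * (2 * pi) \<le> x + pi" "x + pi < (of_int ?k + 1) * (2 * pi)"
    by (simp_all only: pos_le_divide_eq pos_divide_less_eq pi_gt_zero mult_pos_pos zero_less_numeral)
  then have "x - of_int ?k * (2 * pi) \<in> {-pi..pi}"
    by (simp add: algebra_simps)
  from eq[OF this] show ?thesis
    using f.minus_of_int[of x ?k] g.minus_of_int[of x ?k] by simp
qed

lemma wave_solution_dalembert:
  assumes sol: "wave_solution \<Psi>0 \<Psi>1 \<Psi>"
    and g0: "smooth_on UNIV g0" "\<And>x. g0 (x + 2 * pi) = g0 x" "\<And>x. x \<in> {-pi..pi} \<Longrightarrow> \<Psi>0 x = g0 x"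
    and g1: "smooth_on UNIV g1" "\<And>x. g1 (x + 2 * pi) = g1 x" "\<And>x. x \<in> {-pi..pi} \<Longrightarrow> \<Psi>1 x = g1 x"
    and H: "\<And>x. (H has_real_derivative g1 x) (at x)"
    and xt: "(x, t) \<in> strip"
  shows "\<Psi> (x, t) = (g0 (x + t) + g0 (x - t)) / 2 + (H (x + t) - H (x - t)) / 2"
proof -
  have S: "\<Psi> \<in> S_strip" and wave: "wave_equation \<Psi>"
    and circ: "\<And>t. smooth_on_circle (\<lambda>x. \<Psi> (x, t))"
    and i0: "\<And>x. x \<in> {-pi..<pi} \<Longrightarrow> \<Psi> (x, 0) = \<Psi>0 x"
    and i1: "\<And>x. x \<in> {-pi..<pi} \<Longrightarrow> ((\<lambda>t. \<Psi> (x, t)) has_real_derivative \<Psi>1 x) (at 0)"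
    using sol unfolding wave_solution_def by auto
  obtain F G p q where F: "\<And>z. (F has_real_derivative p z) (at z)"
    and G: "\<And>z. (G has_real_derivative q z) (at z)"
    and p: "continuous_on UNIV p" and q: "continuous_on UNIV q"
    and FG0: "\<And>x t. (x, t) \<in> strip_interior \<Longrightarrow> \<Psi> (x, t) = F (x + t) + G (x - t)"
    by (rule smooth_wave_dalembert[OF _ wave]) (use S in \<open>auto simp: S_strip_def\<close>)
  have c0: "continuous_on UNIV F" "continuous_on UNIV G"
    by (rule DERIV_continuous_on, rule F) (rule DERIV_continuous_on, rule G)
  note [continuous_intros] = continuous_on_compose2[OF p] continuous_on_compose2[OF q]
    continuous_on_compose2[OF c0(1)] continuous_on_compose2[OF c0(2)]
  have d: "((\<lambda>x. F (x + t) + G (x - t)) has_real_derivative p (x + t) + q (x - t)) (at x)"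
    "((\<lambda>t. F (x + t) + G (x - t)) has_real_derivative p (x + t) - q (x - t)) (at t)" for x t
    by (auto intro!: derivative_eq_intros DERIV_chain2[OF F] DERIV_chain2[OF G])
  have FG: "\<Psi> (x, t) = F (x + t) + G (x - t)" if "x \<in> {-pi..pi}" for x t
  proof (rule eq_on_closed_interval[OF _ _ _ _ that, where f = "\<lambda>x. \<Psi> (x, t)"])
    show "continuous_on {-pi..pi} (\<lambda>x. \<Psi> (x, t))"
      using S unfolding S_strip_def C_strip_def by blast
  qed (auto intro!: continuous_intros FG0 simp: strip_interior_def)
  \<comment> \<open>The periodic smooth extension of a time slice has equal values and equal
    derivatives at both ends. Its derivative is compared with the profiles inside and reaches the
    ends by continuity.\<close>
  have bd: "F (pi + t) + G (pi - t) = F (- pi + t) + G (- pi - t)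
    \<and> p (pi + t) + q (pi - t) = p (- pi + t) + q (- pi - t)" for t
  proof -
    obtain g where g: "smooth_on UNIV g" "\<And>x. g (x + 2 * pi) = g x"
      "\<And>x. x \<in> {-pi..pi} \<Longrightarrow> \<Psi> (x, t) = g x"
      using circ[of t] unfolding smooth_on_circle_def by blast
    obtain g' where g': "\<And>x. (g has_real_derivative g' x) (at x)" "smooth_on UNIV g'"
      using smooth_on_UNIV_deriv[OF g(1)] by blast
    have e: "g x = F (x + t) + G (x - t)" if "x \<in> {-pi..pi}" for x
      using g(3) FG that by metis
    have "g' x = p (x + t) + q (x - t)" if "x \<in> {-pi..pi}" for x
    proof (rule eq_on_closed_interval[OF _ _ _ _ that, where f = g'])
      fix x assume x: "x \<in> {-pi<..<pi}"
      show "g' x = p (x + t) + q (x - t)"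
        by (rule DERIV_unique[OF g'(1)
              has_field_derivative_transform_within_open[OF d(1) open_greaterThanLessThan x]])
          (simp add: e)
    qed (auto intro!: continuous_intros continuous_on_subset[OF smooth_on_imp_continuous_on[OF g'(2)]])
    then show ?thesis
      using e[of pi] e[of "-pi"] g(2)[of "-pi"] deriv_periodic[OF g'(1) g(2), of "-pi"] by simp
  qed
  \<comment> \<open>The equality of boundary values holds at all times, so both sides have the same
    time derivative.\<close>
  have bd': "p (pi + t) - q (pi - t) = p (- pi + t) - q (- pi - t)" for t
  proof -
    have "((\<lambda>t. F (pi + t) + G (pi - t)) has_real_derivative p (- pi + t) - q (- pi - t)) (at t)"
      using d(2)[of "- pi" t] bd by simp
    then show ?thesis using d(2)[of pi t] DERIV_unique by blast
  qed
  \<comment> \<open>Adding the two relations isolates \<open>p\<close>, subtracting them isolates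
    \<open>q\<close>; the chosen times make - pi + t, respectively - pi - t, equal to z.\<close>
  have pper: "p (z + 2 * pi) = p z" and qper: "q (z + 2 * pi) = q z" for z
    using bd[of "z + pi"] bd'[of "z + pi"] bd[of "- z - pi"] bd'[of "- z - pi"]
    by (simp_all add: algebra_simps)
  obtain g0' where g0': "\<And>x. (g0 has_real_derivative g0' x) (at x)" "smooth_on UNIV g0'"
    using smooth_on_UNIV_deriv[OF g0(1)] by blast
  have init: "p x + q x = g0' x" "p x - q x = g1 x" if x: "x \<in> {-pi<..<pi}" for x
  proof -
    have "F y + G y = g0 y" if "y \<in> {-pi<..<pi}" for y
      using FG[of y 0] i0[of y] g0(3)[of y] that by simp
    then have "(g0 has_real_derivative p x + q x) (at x)"
      using has_field_derivative_transform_within_open[OF d(1)[of 0 x] open_greaterThanLessThan x]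
      by simp
    then show "p x + q x = g0' x" using g0'(1) DERIV_unique by blast
    have "(\<lambda>t. \<Psi> (x, t)) = (\<lambda>t. F (x + t) + G (x - t))" using FG x by auto
    then have "((\<lambda>t. F (x + t) + G (x - t)) has_real_derivative g1 x) (at 0)"
      using i1[of x] g1(3)[of x] x by simp
    then show "p x - q x = g1 x"
      using d(2)[of x 0] by (auto dest: DERIV_unique)
  qed
  have c: "continuous_on {-pi..pi} g0'" "continuous_on {-pi..pi} g1"
    using smooth_on_imp_continuous_on[OF g0'(2)] smooth_on_imp_continuous_on[OF g1(1)]
    by (auto elim: continuous_on_subset)
  have pe: "p z = (g0' z + g1 z) / 2" for z
  proof (rule periodic_eq[where f = p and g = "\<lambda>z. (g0' z + g1 z) / 2"])
    fix x :: real assume x: "x \<in> {-pi..pi}"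
    show "p x = (g0' x + g1 x) / 2"
      by (rule eq_on_closed_interval[OF _ _ _ _ x, where f = p])
        (auto intro!: continuous_intros c simp flip: init)
  qed (simp_all add: pper deriv_periodic[OF g0'(1) g0(2)] g1(2))
  have qe: "q z = (g0' z - g1 z) / 2" for z
  proof (rule periodic_eq[where f = q and g = "\<lambda>z. (g0' z - g1 z) / 2"])
    fix x :: real assume x: "x \<in> {-pi..pi}"
    show "q x = (g0' x - g1 x) / 2"
      by (rule eq_on_closed_interval[OF _ _ _ _ x, where f = q])
        (auto intro!: continuous_intros c simp flip: init)
  qed (simp_all add: qper deriv_periodic[OF g0'(1) g0(2)] g1(2))
  have "((\<lambda>z. F z - (g0 z + H z) / 2) has_real_derivative 0) (at z)"
    "((\<lambda>z. G z - (g0 z - H z) / 2) has_real_derivative 0) (at z)" for z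
    by (auto intro!: derivative_eq_intros F G g0'(1) H simp: pe qe)
  then have "F z - (g0 z + H z) / 2 = F 0 - (g0 0 + H 0) / 2"
    "G z - (g0 z - H z) / 2 = G 0 - (g0 0 - H 0) / 2" for z
    using DERIV_isconst_all[of "\<lambda>z. F z - (g0 z + H z) / 2"]
      DERIV_isconst_all[of "\<lambda>z. G z - (g0 z - H z) / 2"] by blast+
  \<comment> \<open>The profiles are fixed only up to opposite constants. Their sum is all that
    matters, and in it \<open>H 0\<close> cancels.\<close>
  moreover have "F 0 + G 0 = g0 0" using FG[of 0 0] i0[of 0] g0(3)[of 0] by simp
  ultimately show ?thesis
    using FG[of x t] xt by (simp add: strip_def field_simps) (smt (verit))
qed

section \<open>Travelling waves solve the equation\<close>

text \<open>No periodicity of the profiles is asked for, so the result covers both the solution and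
  the current of even data.\<close>

lemma travelling_waves:
  assumes F: "smooth_on UNIV F" and G: "smooth_on UNIV G"
    and u: "\<And>x t. x \<in> {-pi..pi} \<Longrightarrow> u (x, t) = F (x + t) + G (x - t)"
  shows "u \<in> S_strip" "wave_equation u"
proof -
  have slice: "smooth_on {-pi..pi} (\<lambda>x. u (x, t))" for t
  proof (rule smooth_on_cong)
    show "smooth_on {-pi..pi} (\<lambda>x. F (x + t) + G (x + (- t)))"
      by (intro smooth_on_add smooth_on_affine bounded_linear_ident F G)
  qed (simp add: u)
  have joint: "smooth_on T u" if "T \<subseteq> strip" for T
  proof (rule smooth_on_cong)
    have "bounded_linear (\<lambda>p::real \<times> real. fst p + snd p)"
      "bounded_linear (\<lambda>p::real \<times> real. fst p - snd p)"
      by (intro bounded_linear_add bounded_linear_sub bounded_linear_fst bounded_linear_snd)+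
    then show "smooth_on T (\<lambda>p. F (fst p + snd p + 0) + G (fst p - snd p + 0))"
      by (intro smooth_on_add smooth_on_affine F G)
  qed (use that in \<open>auto simp: strip_def u\<close>)
  have "strip_interior \<subseteq> strip" by (auto simp: strip_interior_def strip_def)
  then show "u \<in> S_strip"
    unfolding S_strip_def C_strip_def
    using smooth_on_imp_continuous_on[OF slice] smooth_on_imp_continuous_on[OF joint[of strip]]
      slice joint[of strip_interior] by simp
  obtain F' where F': "\<And>x. (F has_real_derivative F' x) (at x)" "smooth_on UNIV F'"
    using smooth_on_UNIV_deriv[OF F] by blast
  obtain G' where G': "\<And>x. (G has_real_derivative G' x) (at x)" "smooth_on UNIV G'"
    using smooth_on_UNIV_deriv[OF G] by blast
  obtain F'' where F'': "\<And>x. (F' has_real_derivative F'' x) (at x)"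
    using smooth_on_UNIV_deriv[OF F'(2)] by blast
  obtain G'' where G'': "\<And>x. (G' has_real_derivative G'' x) (at x)"
    using smooth_on_UNIV_deriv[OF G'(2)] by blast
  note ch = DERIV_chain2[OF F'(1)] DERIV_chain2[OF G'(1)] DERIV_chain2[OF F''] DERIV_chain2[OF G'']
  show "wave_equation u"
    unfolding wave_equation_def
  proof clarify
    fix x t assume "(x, t) \<in> strip_interior"
    then have x: "x \<in> {-pi<..<pi}" by (auto simp: strip_interior_def)
    have "deriv (\<lambda>r. u (x, r)) s = F' (x + s) - G' (x - s)" for s
      by (rule DERIV_imp_deriv) (use x in \<open>auto simp: u intro!: derivative_eq_intros ch\<close>)
    then have 1: "deriv (\<lambda>s. deriv (\<lambda>r. u (x, r)) s) t = F'' (x + t) + G'' (x - t)"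
      by (simp, intro DERIV_imp_deriv) (auto intro!: derivative_eq_intros ch)
    have dx: "((\<lambda>z. F (z + t) + G (z - t)) has_real_derivative F' (y + t) + G' (y - t)) (at y)"
      "((\<lambda>z. F' (z + t) + G' (z - t)) has_real_derivative F'' (y + t) + G'' (y - t)) (at y)" for y
      by (auto intro!: derivative_eq_intros ch)
    have "deriv (\<lambda>z. u (z, t)) y = F' (y + t) + G' (y - t)" if "y \<in> {-pi<..<pi}" for y
      by (rule DERIV_imp_deriv,
          rule has_field_derivative_transform_within_open[OF dx(1) open_greaterThanLessThan that])
        (simp add: u)
    then have 2: "deriv (\<lambda>y. deriv (\<lambda>z. u (z, t)) y) x = F'' (x + t) + G'' (x - t)"
      by (intro DERIV_imp_deriv
          has_field_derivative_transform_within_open[OF dx(2) open_greaterThanLessThan x]) simp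
    show "deriv (\<lambda>s. deriv (\<lambda>r. u (x, r)) s) t - deriv (\<lambda>y. deriv (\<lambda>z. u (z, t)) y) x = 0"
      using 1 2 by simp
  qed
qed

section \<open>The solution, its current and their series\<close>

lemma DERIV_within_transform:
  fixes f g :: "real \<Rightarrow> real"
  assumes "x \<in> S" "\<And>y. y \<in> S \<Longrightarrow> g y = f y" "(f has_real_derivative D) (at x within S)"
  shows "(g has_real_derivative D) (at x within S)"
  using assms unfolding has_field_derivative_def by (rule has_derivative_transform)

text \<open>\<open>g0\<close> and \<open>g1\<close> are the periodic extensions of the data. The
  normalisation \<open>H 0 = 0\<close> makes \<open>H\<close> odd when \<open>g1\<close> is
  even.\<close>

locale wave_data =
  fixes \<Psi>0 \<Psi>1 g0 g1 g0' H :: "real \<Rightarrow> real"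
  assumes g0: "smooth_on UNIV g0" "\<And>x. g0 (x + 2 * pi) = g0 x" "\<And>x. x \<in> {-pi..pi} \<Longrightarrow> \<Psi>0 x = g0 x"
    and g1: "smooth_on UNIV g1" "\<And>x. g1 (x + 2 * pi) = g1 x" "\<And>x. x \<in> {-pi..pi} \<Longrightarrow> \<Psi>1 x = g1 x"
    and g0': "\<And>x. (g0 has_real_derivative g0' x) (at x)" "smooth_on UNIV g0'"
    and H: "\<And>x. (H has_real_derivative g1 x) (at x)" "H 0 = 0"
begin

abbreviation mean :: real where "mean \<equiv> fourier_cos \<Psi>1 0"

definition Hper :: "real \<Rightarrow> real" where "Hper x = H x - mean * x"

definition dalembert :: "real \<Rightarrow> real \<Rightarrow> real" where
  "dalembert x t = (g0 (x + t) + g0 (x - t)) / 2 + (H (x + t) - H (x - t)) / 2"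

definition dalembert_t :: "real \<Rightarrow> real \<Rightarrow> real" where
  "dalembert_t x t = (g0' (x + t) - g0' (x - t)) / 2 + (g1 (x + t) + g1 (x - t)) / 2"

text \<open>An antiderivative in \<open>x\<close> of \<open>- \<partial>\<^sub>t\<close> of the solution, so the current up to a function of time.\<close>

definition flux :: "real \<Rightarrow> real \<Rightarrow> real" where
  "flux x t = - (g0 (x + t) - g0 (x - t)) / 2 - (H (x + t) + H (x - t)) / 2"

lemma fourier_data:
  "fourier_cos \<Psi>0 = fourier_cos g0" "fourier_sin \<Psi>0 = fourier_sin g0"
  "fourier_cos \<Psi>1 = fourier_cos g1" "fourier_sin \<Psi>1 = fourier_sin g1"
  by (auto simp: fun_eq_iff fourier_cos_def fourier_sin_def g0(3) g1(3) intro!: integral_cong)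

lemma cont: "continuous_on S g0" "continuous_on S g0'" "continuous_on S g1" "continuous_on S H"
  using smooth_on_imp_continuous_on[OF g0(1)] smooth_on_imp_continuous_on[OF g0'(2)]
    smooth_on_imp_continuous_on[OF g1(1)]
    smooth_on_imp_continuous_on[OF smooth_on_UNIV_antideriv[OF H(1) g1(1)]]
  by (auto elim: continuous_on_subset)

lemmas cont_compose [continuous_intros] =
  cont[of UNIV, THEN continuous_on_compose2, OF _ subset_UNIV]

lemma smooth_H: "smooth_on UNIV H"
  by (rule smooth_on_UNIV_antideriv[OF H(1) g1(1)])

lemma smooth_Hper: "smooth_on UNIV Hper"
proof -
  have "((\<lambda>x. - mean * x) has_real_derivative - mean) (at x)" for x
    by (auto intro!: derivative_eq_intros)
  then have "smooth_on UNIV (\<lambda>x. - mean * x)"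
    by (rule smooth_on_UNIV_antideriv[OF _ smooth_on_const])
  from smooth_on_add[OF smooth_H this] show ?thesis unfolding Hper_def by simp
qed

lemma Hper_deriv: "(Hper has_real_derivative g1 x - mean) (at x)"
  unfolding Hper_def by (auto intro!: derivative_eq_intros H)

text \<open>The increment over a period has zero derivative, so it may be evaluated at - pi, where
  it is the integral of \<open>g1\<close> over one period minus 2 pi times the mean.\<close>

lemma Hper_periodic: "Hper (x + 2 * pi) = Hper x"
proof -
  have "((\<lambda>x. Hper (x + 2 * pi)) has_real_derivative g1 x - mean) (at x)" for x
    using Hper_deriv[of "x + 2 * pi"] by (simp add: DERIV_shift g1(2))
  then have "((\<lambda>x. Hper (x + 2 * pi) - Hper x) has_real_derivative (g1 x - mean) - (g1 x - mean)) (at x)" for x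
    by (intro DERIV_diff Hper_deriv)
  then have "Hper (x + 2 * pi) - Hper x = Hper (- pi + 2 * pi) - Hper (- pi)"
    using DERIV_isconst_all[of "\<lambda>x. Hper (x + 2 * pi) - Hper x"] unfolding diff_self by blast
  moreover have "2 * pi * mean = H pi - H (- pi)"
    using integral_eq_FTC[OF _ H(1), of "- pi" pi] by (simp add: fourier_data fourier_cos_def)
  ultimately show ?thesis by (simp add: Hper_def algebra_simps)
qed

text \<open>Integration by parts produces the divisors \<open>m\<close> of the velocity terms;
  subtracting the mean changes no coefficient of positive index.\<close>

lemma fourier_Hper:
  assumes m: "m > 0"
  shows "fourier_sin Hper m = fourier_cos \<Psi>1 m / real m"
    "fourier_cos Hper m = - (fourier_sin \<Psi>1 m / real m)"
proof -
  let ?I = "integral {-pi..pi}"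
  have "continuous_on S (\<lambda>x. g1 x - mean)" for S by (intro continuous_intros cont)
  note parts = fourier_by_parts[where g = Hper and g' = "\<lambda>x. g1 x - mean",
      OF Hper_deriv this Hper_periodic m]
  have "?I (\<lambda>x. (g1 x - mean) * cos (real m * x))
      = ?I (\<lambda>x. g1 x * cos (real m * x) - mean * cos (real m * x))"
    by (simp add: left_diff_distrib)
  also have "\<dots> = ?I (\<lambda>x. g1 x * cos (real m * x)) - mean * ?I (\<lambda>x. cos (real m * x))"
    by (subst integral_diff) (auto intro!: integrable_continuous_real continuous_intros cont)
  also have "?I (\<lambda>x. cos (real m * x)) = 0"
    using integral_cos_int[of "real m"] m by simp
  finally have c: "fourier_cos (\<lambda>x. g1 x - mean) m = fourier_cos \<Psi>1 m"
    by (simp add: fourier_data fourier_cos_def)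
  have "?I (\<lambda>x. (g1 x - mean) * sin (real m * x))
      = ?I (\<lambda>x. g1 x * sin (real m * x) - mean * sin (real m * x))"
    by (simp add: left_diff_distrib)
  also have "\<dots> = ?I (\<lambda>x. g1 x * sin (real m * x)) - mean * ?I (\<lambda>x. sin (real m * x))"
    by (subst integral_diff) (auto intro!: integrable_continuous_real continuous_intros cont)
  also have "?I (\<lambda>x. sin (real m * x)) = 0" by (rule integral_odd) simp
  finally have s: "fourier_sin (\<lambda>x. g1 x - mean) m = fourier_sin \<Psi>1 m"
    by (simp add: fourier_data fourier_sin_def)
  show "fourier_sin Hper m = fourier_cos \<Psi>1 m / real m"
    "fourier_cos Hper m = - (fourier_sin \<Psi>1 m / real m)"
    using parts c s by simp_all
qed

lemma summable_data:
  assumes "\<And>m. \<bar>c m\<bar> \<le> 1" "\<And>m. \<bar>d m\<bar> \<le> 1"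
  shows "(\<lambda>m. fourier_cos \<Psi>0 m * c m * d m) summable_on {1..}"
    "(\<lambda>m. fourier_sin \<Psi>0 m * c m * d m) summable_on {1..}"
    "(\<lambda>m. fourier_cos \<Psi>1 m / real m * c m * d m) summable_on {1..}"
    "(\<lambda>m. fourier_sin \<Psi>1 m / real m * c m * d m) summable_on {1..}"
proof -
  show "(\<lambda>m. fourier_cos \<Psi>0 m * c m * d m) summable_on {1..}"
    "(\<lambda>m. fourier_sin \<Psi>0 m * c m * d m) summable_on {1..}"
    unfolding fourier_data by (rule fourier_summable[OF g0(1,2) assms])+
  have "(\<lambda>m. fourier_sin Hper m * c m * d m) summable_on {1..}"
    "(\<lambda>m. fourier_cos Hper m * c m * d m) summable_on {1..}"
    by (rule fourier_summable[OF smooth_Hper Hper_periodic assms])+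
  then show "(\<lambda>m. fourier_cos \<Psi>1 m / real m * c m * d m) summable_on {1..}"
    "(\<lambda>m. fourier_sin \<Psi>1 m / real m * c m * d m) summable_on {1..}"
    using summable_on_cong[of "{1..}" "\<lambda>m. fourier_sin Hper m * c m * d m"
        "\<lambda>m. fourier_cos \<Psi>1 m / real m * c m * d m"]
      summable_on_cong[of "{1..}" "\<lambda>m. fourier_cos Hper m * c m * d m"
        "\<lambda>m. - (fourier_sin \<Psi>1 m / real m * c m * d m)"]
      summable_on_uminus[of "\<lambda>m. - (fourier_sin \<Psi>1 m / real m * c m * d m)" "{1..}"]
    by (simp_all add: fourier_Hper)
qed

lemma infsum_Hper:
  "(\<Sum>\<^sub>\<infinity>m\<in>{1..}. fourier_sin Hper m * c m * d m) = (\<Sum>\<^sub>\<infinity>m\<in>{1..}. fourier_cos \<Psi>1 m / real m * c m * d m)"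
  "(\<Sum>\<^sub>\<infinity>m\<in>{1..}. fourier_cos Hper m * c m * d m) = - (\<Sum>\<^sub>\<infinity>m\<in>{1..}. fourier_sin \<Psi>1 m / real m * c m * d m)"
  by (auto simp: fourier_Hper simp flip: infsum_uminus intro!: infsum_cong)

text \<open>Half the difference of mean (x + t) and mean (x - t) is the term linear in
  \<open>t\<close>; what remains involves only periodic functions.\<close>

lemma dalembert_series:
  "dalembert x t = fourier_cos \<Psi>0 0 + t * mean
    + 2 * (\<Sum>\<^sub>\<infinity>m\<in>{1..}. fourier_cos \<Psi>0 m * cos (real m * x) * cos (real m * t))
    + 2 * (\<Sum>\<^sub>\<infinity>m\<in>{1..}. fourier_sin \<Psi>0 m * sin (real m * x) * cos (real m * t))
    + 2 * (\<Sum>\<^sub>\<infinity>m\<in>{1..}. fourier_cos \<Psi>1 m / real m * cos (real m * x) * sin (real m * t))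
    + 2 * (\<Sum>\<^sub>\<infinity>m\<in>{1..}. fourier_sin \<Psi>1 m / real m * sin (real m * x) * sin (real m * t))"
proof -
  have "dalembert x t = (g0 (x + t) + g0 (x - t)) / 2 + (Hper (x + t) - Hper (x - t)) / 2 + t * mean"
    by (simp add: dalembert_def Hper_def field_simps)
  then show ?thesis
    unfolding fourier_even_translates[OF g0(1,2)] fourier_odd_translates[OF smooth_Hper Hper_periodic]
      infsum_Hper fourier_data(1,2) by simp
qed

lemma deriv_translates:
  fixes f f' :: "real \<Rightarrow> real"
  assumes "\<And>x. (f has_real_derivative f' x) (at x)"
  shows "((\<lambda>t. f (x + t)) has_real_derivative f' (x + t)) (at t)"
    "((\<lambda>t. f (x - t)) has_real_derivative - f' (x - t)) (at t)"
    "((\<lambda>x. f (x + t)) has_real_derivative f' (x + t)) (at x)"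
    "((\<lambda>x. f (x - t)) has_real_derivative f' (x - t)) (at x)"
proof -
  have "((\<lambda>t. x + t) has_real_derivative 1) (at t)" "((\<lambda>t. x - t) has_real_derivative - 1) (at t)"
    "((\<lambda>x. x + t) has_real_derivative 1) (at x)" "((\<lambda>x. x - t) has_real_derivative 1) (at x)"
    by (auto intro!: derivative_eq_intros)
  from this[THEN DERIV_chain2[OF assms]] show
    "((\<lambda>t. f (x + t)) has_real_derivative f' (x + t)) (at t)"
    "((\<lambda>t. f (x - t)) has_real_derivative - f' (x - t)) (at t)"
    "((\<lambda>x. f (x + t)) has_real_derivative f' (x + t)) (at x)"
    "((\<lambda>x. f (x - t)) has_real_derivative f' (x - t)) (at x)"
    by simp_all
qed

lemmas data_translates = deriv_translates[OF g0'(1)] deriv_translates[OF H(1)]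

lemma dalembert_deriv:
  "(dalembert x has_real_derivative dalembert_t x t) (at t)"
  "((\<lambda>x. dalembert x t) has_real_derivative
    (g0' (x + t) + g0' (x - t)) / 2 + (g1 (x + t) - g1 (x - t)) / 2) (at x)"
  unfolding dalembert_def dalembert_t_def
  by (auto intro!: derivative_eq_intros data_translates simp: field_simps)

text \<open>With A = (g0 + H)/2 and B = (g0 - H)/2, the solution is A (x + t) + B (x - t) and the
  flux is - A (x + t) + B (x - t). Reversing the sign of one wave exchanges the space and time
  derivatives up to sign.\<close>

lemma flux_deriv:
  "((\<lambda>x. flux x t) has_real_derivative - dalembert_t x t) (at x)"
  "(flux x has_real_derivative
    - ((g0' (x + t) + g0' (x - t)) / 2 + (g1 (x + t) - g1 (x - t)) / 2)) (at t)"
  unfolding flux_def dalembert_t_def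
  by (auto intro!: derivative_eq_intros data_translates simp: field_simps)

lemma smooth_half_sums:
  "smooth_on UNIV (\<lambda>z. (1/2) * (g0 z + H z))" "smooth_on UNIV (\<lambda>z. (1/2) * (g0 z + (- 1) * H z))"
  by (intro smooth_on_cmult smooth_on_add g0(1) smooth_H)+

lemma H_shift: "H (x + 2 * pi) = H x + 2 * pi * mean"
  using Hper_periodic[of x] by (simp add: Hper_def algebra_simps)

lemma shift_args:
  fixes x t :: real
  shows "x + 2 * pi + t = (x + t) + 2 * pi" "x + 2 * pi - t = (x - t) + 2 * pi"
  by simp_all

lemma wave_solution_of_dalembert:
  assumes u: "\<And>x t. x \<in> {-pi..pi} \<Longrightarrow> u (x, t) = dalembert x t"
  shows "wave_solution \<Psi>0 \<Psi>1 u"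
  unfolding wave_solution_def
proof (intro conjI allI ballI)
  have "u (x, t) = (1/2) * (g0 (x + t) + H (x + t)) + (1/2) * (g0 (x - t) + (- 1) * H (x - t))"
    if "x \<in> {-pi..pi}" for x t
    using u[OF that] by (simp add: dalembert_def field_simps)
  note travelling_waves[OF smooth_half_sums this]
  then show "u \<in> S_strip" "wave_equation u" by blast+
  fix t
  have "smooth_on UNIV (\<lambda>x. (1/2) * (g0 (x + t) + H (x + t))
      + (1/2) * (g0 (x + - t) + (- 1) * H (x + - t)))"
    by (intro smooth_on_add smooth_on_cmult smooth_on_affine bounded_linear_ident g0(1) smooth_H)
  moreover have "(\<lambda>x. (1/2) * (g0 (x + t) + H (x + t))
      + (1/2) * (g0 (x + - t) + (- 1) * H (x + - t))) = (\<lambda>x. dalembert x t)"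
    by (simp add: dalembert_def field_simps fun_eq_iff)
  \<comment> \<open>Both \<open>H\<close> terms gain 2 pi mean, and their difference does not see
    it.\<close>
  moreover have "dalembert (x + 2 * pi) t = dalembert x t" for x
    unfolding dalembert_def shift_args g0(2) H_shift by simp
  ultimately show "smooth_on_circle (\<lambda>x. u (x, t))"
    unfolding smooth_on_circle_def using u by auto
next
  fix x assume x: "x \<in> {-pi..<pi}"
  then show "u (x, 0) = \<Psi>0 x" by (simp add: u dalembert_def g0(3))
  have "(\<lambda>t. u (x, t)) = dalembert x" using u x by auto
  then show "((\<lambda>t. u (x, t)) has_real_derivative \<Psi>1 x) (at 0)"
    using dalembert_deriv(1)[of x 0] x by (simp add: dalembert_t_def g1(3))
qed

lemma solution_eq_dalembert:
  assumes "wave_solution \<Psi>0 \<Psi>1 u" "x \<in> {-pi..pi}"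
  shows "u (x, t) = dalembert x t"
  unfolding dalembert_def
  by (rule wave_solution_dalembert[OF assms(1) g0 g1 H(1)]) (use assms(2) in \<open>auto simp: strip_def\<close>)

text \<open>\<open>wave_solution\<close> depends only on values on the strip; restricting to
  extensional functions fixes the values elsewhere.\<close>

lemma ex1_solution: "\<exists>!u. u \<in> extensional strip \<and> wave_solution \<Psi>0 \<Psi>1 u"
proof (rule ex_ex1I)
  have "wave_solution \<Psi>0 \<Psi>1 (restrict (\<lambda>(x, t). dalembert x t) strip)"
    by (rule wave_solution_of_dalembert) (simp add: strip_def)
  then show "\<exists>u. u \<in> extensional strip \<and> wave_solution \<Psi>0 \<Psi>1 u"
    by (intro exI[of _ "restrict (\<lambda>(x, t). dalembert x t) strip"]) simp
next
  fix u v
  assume u: "u \<in> extensional strip \<and> wave_solution \<Psi>0 \<Psi>1 u"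
    and v: "v \<in> extensional strip \<and> wave_solution \<Psi>0 \<Psi>1 v"
  show "u = v"
  proof (rule extensionalityI)
    fix p assume "p \<in> strip"
    then obtain x t where "p = (x, t)" "x \<in> {-pi..pi}" by (auto simp: strip_def)
    then show "u p = v p"
      using solution_eq_dalembert[of u x t] solution_eq_dalembert[of v x t] u v by simp
  qed (use u v in auto)
qed

section \<open>The current and the total\<close>

lemma current_eq_integral:
  assumes "wave_solution \<Psi>0 \<Psi>1 \<Psi>" "x \<in> {-pi..pi}"
  shows "current \<Psi> (x, t) = integral {-pi..x} (\<lambda>y. - dalembert_t y t)"
proof -
  have "deriv (\<lambda>s. \<Psi> (y, s)) t = dalembert_t y t" if "y \<in> {-pi..x}" for y
  proof -
    have "(\<lambda>s. \<Psi> (y, s)) = dalembert y" using solution_eq_dalembert[OF assms(1)] that assms(2) by auto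
    then show ?thesis using DERIV_imp_deriv[OF dalembert_deriv(1)] by simp
  qed
  then show ?thesis unfolding current_def by (auto intro!: integral_cong)
qed

lemma current_eq_flux:
  assumes "wave_solution \<Psi>0 \<Psi>1 \<Psi>" "x \<in> {-pi..pi}"
  shows "current \<Psi> (x, t) = flux x t - flux (- pi) t"
  unfolding current_eq_integral[OF assms]
  by (rule integral_eq_FTC) (use assms(2) flux_deriv(1) in auto)

lemma continuity_equation:
  assumes sol: "wave_solution \<Psi>0 \<Psi>1 \<Psi>" and x: "x \<in> {-pi..pi}"
  shows "((\<lambda>s. \<Psi> (x, s)) has_real_derivative dalembert_t x t) (at t)"
    "((\<lambda>y. current \<Psi> (y, t)) has_real_derivative - dalembert_t x t) (at x within {-pi..pi})"
proof -
  have "(\<lambda>s. \<Psi> (x, s)) = dalembert x" using solution_eq_dalembert[OF sol x] by auto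
  then show "((\<lambda>s. \<Psi> (x, s)) has_real_derivative dalembert_t x t) (at t)"
    using dalembert_deriv(1) by simp
  have "((\<lambda>y. flux y t - flux (- pi) t) has_real_derivative - dalembert_t x t) (at x within {-pi..pi})"
    using DERIV_diff[OF DERIV_subset[OF flux_deriv(1)] DERIV_const] by simp
  then show "((\<lambda>y. current \<Psi> (y, t)) has_real_derivative - dalembert_t x t) (at x within {-pi..pi})"
    by (rule DERIV_within_transform[OF x _ , rotated]) (rule current_eq_flux[OF sol])
qed

text \<open>Translates of periodic functions have equal integrals over a period, so the two
  \<open>g0\<close> terms combine, the two \<open>Hper\<close> terms cancel, and the linear term in
  \<open>t\<close> survives.\<close>

lemma integral_dalembert: "integral {-pi..pi} (\<lambda>x. dalembert x t) = 2 * pi * (fourier_cos \<Psi>0 0 + t * mean)"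
proof -
  let ?I = "integral {-pi..pi}"
  have c: "continuous_on S Hper" for S
    using smooth_on_imp_continuous_on[OF smooth_Hper] by (auto elim: continuous_on_subset)
  note [continuous_intros] = continuous_on_compose2[OF c[of UNIV] _ subset_UNIV]
  have "dalembert x t = (g0 (x + t) / 2 + g0 (x + - t) / 2)
      + ((Hper (x + t) / 2 - Hper (x + - t) / 2) + t * mean)" for x
    by (simp add: dalembert_def Hper_def field_simps)
  then have "?I (\<lambda>x. dalembert x t) = ?I (\<lambda>x. (g0 (x + t) / 2 + g0 (x + - t) / 2)
      + ((Hper (x + t) / 2 - Hper (x + - t) / 2) + t * mean))"
    by simp
  also have "\<dots> = (?I (\<lambda>x. g0 (x + t)) / 2 + ?I (\<lambda>x. g0 (x + - t)) / 2)
      + ((?I (\<lambda>x. Hper (x + t)) / 2 - ?I (\<lambda>x. Hper (x + - t)) / 2) + 2 * pi * (t * mean))"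
    by (subst integral_add integral_diff;
        (intro integrable_continuous_real continuous_intros)?; simp)+
  also have "\<dots> = ?I g0 + 2 * pi * (t * mean)"
    unfolding integral_periodic_shift[OF cont(1) g0(2)] integral_periodic_shift[OF c Hper_periodic]
    by simp
  also have "?I g0 = 2 * pi * fourier_cos \<Psi>0 0" by (simp add: fourier_data fourier_cos_def)
  finally show ?thesis by (simp add: algebra_simps)
qed

text \<open>The current is zero at the left end but equals -2 pi mean at the right end. This net
  flow makes the total change at rate 2 pi mean, so comparing times 0 and 1 already forces the mean
  to vanish.\<close>

lemma conserved_iff:
  assumes "wave_solution \<Psi>0 \<Psi>1 \<Psi>"
  shows "(\<forall>t. integral {-pi..pi} (\<lambda>x. \<Psi> (x, t)) = integral {-pi..pi} (\<lambda>x. \<Psi> (x, 0))) \<longleftrightarrow> mean = 0"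
proof -
  have "integral {-pi..pi} (\<lambda>x. \<Psi> (x, t)) = 2 * pi * (fourier_cos \<Psi>0 0 + t * mean)" for t
    unfolding integral_dalembert[symmetric]
    by (rule integral_cong) (rule solution_eq_dalembert[OF assms])
  then show ?thesis by (auto dest: spec[of _ 1])
qed

end

section \<open>Even data and the conjugate wave\<close>

locale even_wave_data = wave_data +
  assumes even0: "\<And>x. x \<in> {-pi..pi} \<Longrightarrow> \<Psi>0 (- x) = \<Psi>0 x"
    and even1: "\<And>x. x \<in> {-pi..pi} \<Longrightarrow> \<Psi>1 (- x) = \<Psi>1 x"
begin

lemma fourier_sin_0: "fourier_sin \<Psi>0 m = 0" "fourier_sin \<Psi>1 m = 0"
  unfolding fourier_sin_def using integral_odd[of "\<lambda>x. \<Psi>0 x * sin (real m * x)"]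
    integral_odd[of "\<lambda>x. \<Psi>1 x * sin (real m * x)"] even0 even1 by simp_all

lemma even_ext: "g0 (- x) = g0 x" "g1 (- x) = g1 x"
proof -
  have *: "g (- x) = g x" if per: "\<And>x. g (x + 2 * pi) = g x"
    and ev: "\<And>x. x \<in> {-pi..pi} \<Longrightarrow> g (- x) = g x" for g :: "real \<Rightarrow> real" and x
  proof (rule periodic_eq[where f = "\<lambda>x. g (- x)"])
    show "g (- (x + 2 * pi)) = g (- x)" for x using per[of "- x - 2 * pi"] by simp
  qed (use that in auto)
  have "g0 (- x) = g0 x" if "x \<in> {-pi..pi}" for x
    using even0[OF that] g0(3)[of x] g0(3)[of "- x"] that by simp
  then show "g0 (- x) = g0 x" by (rule *[where g = g0, OF g0(2)])
  have "g1 (- x) = g1 x" if "x \<in> {-pi..pi}" for x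
    using even1[OF that] g1(3)[of x] g1(3)[of "- x"] that by simp
  then show "g1 (- x) = g1 x" by (rule *[where g = g1, OF g1(2)])
qed

lemma H_odd: "H (- x) = - H x"
proof -
  have "((\<lambda>x. H x + H (- x)) has_real_derivative 0) (at x)" for x
    by (auto intro!: derivative_eq_intros DERIV_chain2[OF H(1)] simp: even_ext)
  then have "H x + H (- x) = H 0 + H (- 0)"
    using DERIV_isconst_all[of "\<lambda>x. H x + H (- x)"] by blast
  then show ?thesis by (simp add: H(2))
qed

text \<open>The current is the flux minus its value at the left end. Evenness together with the
  period shift makes that value independent of time, so it contributes nothing to the time
  derivative of the current.\<close>

lemma flux_left: "flux (- pi) t = mean * pi"
proof -
  have "g0 (- pi + t) = g0 (- pi - t)"
    using even_ext(1)[of "- pi - t"] g0(2)[of "- pi + t"] by (simp add: algebra_simps)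
  moreover have "H (- pi + t) + H (- pi - t) = - 2 * pi * mean"
    using H_odd[of "- pi - t"] H_shift[of "- pi + t"] by (simp add: algebra_simps)
  ultimately show ?thesis by (simp add: flux_def)
qed

lemma current_eq:
  assumes "wave_solution \<Psi>0 \<Psi>1 \<Psi>" "x \<in> {-pi..pi}"
  shows "current \<Psi> (x, t) = flux x t - mean * pi"
  using current_eq_flux[OF assms] flux_left by simp

lemma current_wave:
  assumes sol: "wave_solution \<Psi>0 \<Psi>1 \<Psi>"
  shows "current \<Psi> \<in> S_strip" "wave_equation (current \<Psi>)"
proof -
  have "smooth_on UNIV (\<lambda>z. (- 1) * ((1/2) * (g0 z + H z)))"
    "smooth_on UNIV (\<lambda>z. (1/2) * (g0 z + (- 1) * H z) + (- (mean * pi)))"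
    by (intro smooth_on_add smooth_on_cmult smooth_on_const g0(1) smooth_H)+
  moreover have "current \<Psi> (x, t) = (- 1) * ((1/2) * (g0 (x + t) + H (x + t)))
      + ((1/2) * (g0 (x - t) + (- 1) * H (x - t)) + (- (mean * pi)))" if "x \<in> {-pi..pi}" for x t
    using current_eq[OF sol that] by (simp add: flux_def field_simps)
  ultimately show "current \<Psi> \<in> S_strip" "wave_equation (current \<Psi>)"
    using travelling_waves by blast+
qed

text \<open>Compared with the solution, sum and difference of translates trade places between
  \<open>g0\<close> and \<open>Hper\<close>, and the linear part of \<open>H\<close> now yields a
  term in \<open>x\<close>. Oddness of \<open>Hper\<close> removes its constant coefficient.\<close>

lemma flux_series:
  "flux x t = - mean * x
    + 2 * (\<Sum>\<^sub>\<infinity>m\<in>{1..}. fourier_cos \<Psi>0 m * sin (real m * x) * sin (real m * t))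
    - 2 * (\<Sum>\<^sub>\<infinity>m\<in>{1..}. fourier_cos \<Psi>1 m / real m * sin (real m * x) * cos (real m * t))"
proof -
  have "fourier_cos Hper 0 = 0"
    unfolding fourier_cos_def by (subst integral_odd) (auto simp: Hper_def H_odd)
  then have 1: "(Hper (x + t) + Hper (x - t)) / 2
      = 2 * (\<Sum>\<^sub>\<infinity>m\<in>{1..}. fourier_cos \<Psi>1 m / real m * sin (real m * x) * cos (real m * t))"
    unfolding fourier_even_translates[OF smooth_Hper Hper_periodic] infsum_Hper
    by (simp add: fourier_sin_0)
  have 2: "(g0 (x + t) - g0 (x - t)) / 2
      = - 2 * (\<Sum>\<^sub>\<infinity>m\<in>{1..}. fourier_cos \<Psi>0 m * sin (real m * x) * sin (real m * t))"
    unfolding fourier_odd_translates[OF g0(1,2)] using fourier_sin_0(1)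
    by (simp add: fourier_data(1,2))
  have "flux x t = - ((g0 (x + t) - g0 (x - t)) / 2) - (Hper (x + t) + Hper (x - t)) / 2 - mean * x"
    by (simp add: flux_def Hper_def field_simps)
  then show ?thesis unfolding 1 2 by simp
qed

text \<open>In the flux the \<open>H\<close> terms are added, so their gains over a period no longer
  cancel: the current jumps by -2 pi mean between the two ends.\<close>

lemma current_circle_iff:
  assumes sol: "wave_solution \<Psi>0 \<Psi>1 \<Psi>"
  shows "(\<forall>t. smooth_on_circle (\<lambda>x. current \<Psi> (x, t))) \<longleftrightarrow> mean = 0"
proof
  assume "\<forall>t. smooth_on_circle (\<lambda>x. current \<Psi> (x, t))"
  then obtain g where g: "\<And>x. g (x + 2 * pi) = g x"
    "\<And>x. x \<in> {-pi..pi} \<Longrightarrow> current \<Psi> (x, 0) = g x"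
    unfolding smooth_on_circle_def by blast
  have "current \<Psi> (pi, 0) = current \<Psi> (- pi, 0)"
    using g(1)[of "- pi"] g(2)[of pi] g(2)[of "- pi"] by simp
  then have "H pi = H (- pi)"
    using current_eq[OF sol, of pi 0] current_eq[OF sol, of "- pi" 0] by (simp add: flux_def)
  then show "mean = 0" using H_shift[of "- pi"] by simp
next
  assume m: "mean = 0"
  show "\<forall>t. smooth_on_circle (\<lambda>x. current \<Psi> (x, t))"
  proof
    fix t
    have "smooth_on UNIV (\<lambda>x. (- 1/2) * (g0 (x + t) + H (x + t))
        + (1/2) * (g0 (x + - t) + (- 1) * H (x + - t)))"
      by (intro smooth_on_add smooth_on_cmult smooth_on_affine bounded_linear_ident g0(1) smooth_H)
    moreover have "(\<lambda>x. (- 1/2) * (g0 (x + t) + H (x + t))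
        + (1/2) * (g0 (x + - t) + (- 1) * H (x + - t))) = (\<lambda>x. flux x t)"
      by (simp add: flux_def field_simps fun_eq_iff)
    moreover have "flux (x + 2 * pi) t = flux x t" for x
      unfolding flux_def shift_args g0(2) H_shift m by simp
    ultimately show "smooth_on_circle (\<lambda>x. current \<Psi> (x, t))"
      unfolding smooth_on_circle_def using current_eq[OF sol] m by auto
  qed
qed

lemma conjugate_equation:
  assumes sol: "wave_solution \<Psi>0 \<Psi>1 \<Psi>" and x: "x \<in> {-pi..pi}"
  fixes t
  defines "d \<equiv> (g0' (x + t) + g0' (x - t)) / 2 + (g1 (x + t) - g1 (x - t)) / 2"
  shows "((\<lambda>s. current \<Psi> (x, s)) has_real_derivative - d) (at t)"
    "((\<lambda>y. \<Psi> (y, t)) has_real_derivative d) (at x within {-pi..pi})"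
proof -
  have "(\<lambda>s. current \<Psi> (x, s)) = (\<lambda>s. flux x s - mean * pi)" using current_eq[OF sol x] by auto
  then show "((\<lambda>s. current \<Psi> (x, s)) has_real_derivative - d) (at t)"
    using DERIV_diff[OF flux_deriv(2) DERIV_const] by (simp add: d_def)
  show "((\<lambda>y. \<Psi> (y, t)) has_real_derivative d) (at x within {-pi..pi})"
    unfolding d_def
    by (rule DERIV_within_transform[OF x _ DERIV_subset[OF dalembert_deriv(2)]])
      (auto intro: solution_eq_dalembert[OF sol])
qed

end

text \<open>Summability is asserted along with the series because \<open>infsum\<close> is 0 by
  default on a family that is not summable. Derivatives in \<open>x\<close> are taken within the
  interval, hence one-sided at its ends.\<close>

theorem lemma2p3:
  fixes \<Psi>0 \<Psi>1 :: "real \<Rightarrow> real"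
    and a b a' b' :: "nat \<Rightarrow> real"
  assumes "smooth_on_circle \<Psi>0" and "smooth_on_circle \<Psi>1"
    and "a = fourier_cos \<Psi>0" and "b = fourier_sin \<Psi>0"
    and "a' = fourier_cos \<Psi>1" and "b' = fourier_sin \<Psi>1"
  shows
    "(\<exists>!\<Psi>. \<Psi> \<in> extensional strip \<and> wave_solution \<Psi>0 \<Psi>1 \<Psi>) \<and>
     (\<forall>\<Psi>. wave_solution \<Psi>0 \<Psi>1 \<Psi> \<longrightarrow>
       (\<forall>(x, t) \<in> strip.
          (\<lambda>m. a m * cos (real m * x) * cos (real m * t)) summable_on {1..} \<and>
          (\<lambda>m. b m * sin (real m * x) * cos (real m * t)) summable_on {1..} \<and>
          (\<lambda>m. a' m / real m * cos (real m * x) * sin (real m * t)) summable_on {1..} \<and>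
          (\<lambda>m. b' m / real m * sin (real m * x) * sin (real m * t)) summable_on {1..} \<and>
          \<Psi> (x, t) = a 0 + t * a' 0
            + 2 * (\<Sum>\<^sub>\<infinity>m\<in>{1..}. a m * cos (real m * x) * cos (real m * t))
            + 2 * (\<Sum>\<^sub>\<infinity>m\<in>{1..}. b m * sin (real m * x) * cos (real m * t))
            + 2 * (\<Sum>\<^sub>\<infinity>m\<in>{1..}. a' m / real m * cos (real m * x) * sin (real m * t))
            + 2 * (\<Sum>\<^sub>\<infinity>m\<in>{1..}. b' m / real m * sin (real m * x) * sin (real m * t))) \<and>
       (let \<rho> = \<Psi>; J = current \<rho>; P = (\<lambda>t. integral {-pi..pi} (\<lambda>x. \<rho> (x, t))) in
         (\<forall>(x, t) \<in> strip. \<exists>\<rho>\<^sub>t J\<^sub>x.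
            ((\<lambda>s. \<rho> (x, s)) has_real_derivative \<rho>\<^sub>t) (at t) \<and>
            ((\<lambda>y. J (y, t)) has_real_derivative J\<^sub>x) (at x within {-pi..pi}) \<and>
            \<rho>\<^sub>t + J\<^sub>x = 0) \<and>
         ((\<forall>t. P t = P 0) \<longleftrightarrow> a' 0 = 0) \<and>
         ((\<forall>x\<in>{-pi..pi}. \<Psi>0 (- x) = \<Psi>0 x) \<and> (\<forall>x\<in>{-pi..pi}. \<Psi>1 (- x) = \<Psi>1 x) \<longrightarrow>
           (\<forall>(x, t) \<in> strip. \<exists>J\<^sub>t \<rho>\<^sub>x.
              ((\<lambda>s. J (x, s)) has_real_derivative J\<^sub>t) (at t) \<and>
              ((\<lambda>y. \<rho> (y, t)) has_real_derivative \<rho>\<^sub>x) (at x within {-pi..pi}) \<and>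
              J\<^sub>t = - \<rho>\<^sub>x) \<and>
           wave_equation J \<and> J \<in> S_strip \<and>
           ((\<forall>t. smooth_on_circle (\<lambda>x. J (x, t))) \<longleftrightarrow> a' 0 = 0) \<and>
           (\<forall>(x, t) \<in> strip.
              \<rho> (x, t) = a 0 + a' 0 * t
                + 2 * (\<Sum>\<^sub>\<infinity>m\<in>{1..}. a m * cos (real m * x) * cos (real m * t))
                + 2 * (\<Sum>\<^sub>\<infinity>m\<in>{1..}. a' m / real m * cos (real m * x) * sin (real m * t))) \<and>
           (\<forall>(x, t) \<in> strip.
              (\<lambda>m. a m * sin (real m * x) * sin (real m * t)) summable_on {1..} \<and>
              (\<lambda>m. a' m / real m * sin (real m * x) * cos (real m * t)) summable_on {1..} \<and>
              J (x, t) = - a' 0 * pi - a' 0 * x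
                + 2 * (\<Sum>\<^sub>\<infinity>m\<in>{1..}. a m * sin (real m * x) * sin (real m * t))
                - 2 * (\<Sum>\<^sub>\<infinity>m\<in>{1..}. a' m / real m * sin (real m * x) * cos (real m * t))))))"
proof -
  obtain g0 where g0: "smooth_on UNIV g0" "\<And>x. g0 (x + 2 * pi) = g0 x"
    "\<And>x. x \<in> {-pi..pi} \<Longrightarrow> \<Psi>0 x = g0 x"
    using assms(1) unfolding smooth_on_circle_def by blast
  obtain g1 where g1: "smooth_on UNIV g1" "\<And>x. g1 (x + 2 * pi) = g1 x"
    "\<And>x. x \<in> {-pi..pi} \<Longrightarrow> \<Psi>1 x = g1 x"
    using assms(2) unfolding smooth_on_circle_def by blast
  obtain g0' where g0': "\<And>x. (g0 has_real_derivative g0' x) (at x)" "smooth_on UNIV g0'"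
    using smooth_on_UNIV_deriv[OF g0(1)] by blast
  obtain H0 where H0: "\<And>x. (H0 has_real_derivative g1 x) (at x)"
    using antideriv_UNIV[OF smooth_on_imp_continuous_on[OF g1(1)]] by blast
  have "((\<lambda>x. H0 x - H0 0) has_real_derivative g1 x) (at x)" for x
    using DERIV_diff[OF H0 DERIV_const] by simp
  then interpret wave_data \<Psi>0 \<Psi>1 g0 g1 g0' "\<lambda>x. H0 x - H0 0"
    by unfold_locales (use g0 g1 g0' in auto)
  have even: "even_wave_data \<Psi>0 \<Psi>1 g0 g1 g0' (\<lambda>x. H0 x - H0 0)"
    if "(\<forall>x\<in>{-pi..pi}. \<Psi>0 (- x) = \<Psi>0 x) \<and> (\<forall>x\<in>{-pi..pi}. \<Psi>1 (- x) = \<Psi>1 x)"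
    by unfold_locales (use that in auto)
  \<comment> \<open>Replaces quantification over pairs by separate quantifiers, so that introduction
    rules reach every clause.\<close>
  have strip: "(\<forall>(x, t)\<in>strip. Q x t) \<longleftrightarrow> (\<forall>x\<in>{-pi..pi}. \<forall>t. Q x t)" for Q :: "real \<Rightarrow> real \<Rightarrow> bool"
    by (auto simp: strip_def)
  show ?thesis
    unfolding assms(3-6) Let_def strip
  proof (intro conjI ex1_solution allI impI ballI conserved_iff)
    fix \<Psi> x t
    assume sol: "wave_solution \<Psi>0 \<Psi>1 \<Psi>" and x: "x \<in> {-pi..pi}"
    show "\<Psi> (x, t) = fourier_cos \<Psi>0 0 + t * fourier_cos \<Psi>1 0
        + 2 * (\<Sum>\<^sub>\<infinity>m\<in>{1..}. fourier_cos \<Psi>0 m * cos (real m * x) * cos (real m * t))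
        + 2 * (\<Sum>\<^sub>\<infinity>m\<in>{1..}. fourier_sin \<Psi>0 m * sin (real m * x) * cos (real m * t))
        + 2 * (\<Sum>\<^sub>\<infinity>m\<in>{1..}. fourier_cos \<Psi>1 m / real m * cos (real m * x) * sin (real m * t))
        + 2 * (\<Sum>\<^sub>\<infinity>m\<in>{1..}. fourier_sin \<Psi>1 m / real m * sin (real m * x) * sin (real m * t))"
      unfolding solution_eq_dalembert[OF sol x] by (rule dalembert_series)
    show "\<exists>\<rho>\<^sub>t J\<^sub>x. ((\<lambda>s. \<Psi> (x, s)) has_real_derivative \<rho>\<^sub>t) (at t) \<and>
        ((\<lambda>y. current \<Psi> (y, t)) has_real_derivative J\<^sub>x) (at x within {-pi..pi}) \<and> \<rho>\<^sub>t + J\<^sub>x = 0"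
      using continuity_equation[OF sol x, of t] by force
  next
    fix \<Psi>
    assume sol: "wave_solution \<Psi>0 \<Psi>1 \<Psi>"
      and ev: "(\<forall>x\<in>{-pi..pi}. \<Psi>0 (- x) = \<Psi>0 x) \<and> (\<forall>x\<in>{-pi..pi}. \<Psi>1 (- x) = \<Psi>1 x)"
    interpret even_wave_data \<Psi>0 \<Psi>1 g0 g1 g0' "\<lambda>x. H0 x - H0 0" by (rule even[OF ev])
    show "wave_equation (current \<Psi>)" "current \<Psi> \<in> S_strip" by (rule current_wave[OF sol])+
    show "(\<forall>t. smooth_on_circle (\<lambda>x. current \<Psi> (x, t))) \<longleftrightarrow> fourier_cos \<Psi>1 0 = 0"
      by (rule current_circle_iff[OF sol])
    fix x t assume x: "x \<in> {-pi..pi}"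
    show "\<exists>J\<^sub>t \<rho>\<^sub>x. ((\<lambda>s. current \<Psi> (x, s)) has_real_derivative J\<^sub>t) (at t) \<and>
        ((\<lambda>y. \<Psi> (y, t)) has_real_derivative \<rho>\<^sub>x) (at x within {-pi..pi}) \<and> J\<^sub>t = - \<rho>\<^sub>x"
      using conjugate_equation[OF sol x, of t] by blast
    show "\<Psi> (x, t) = fourier_cos \<Psi>0 0 + fourier_cos \<Psi>1 0 * t
        + 2 * (\<Sum>\<^sub>\<infinity>m\<in>{1..}. fourier_cos \<Psi>0 m * cos (real m * x) * cos (real m * t))
        + 2 * (\<Sum>\<^sub>\<infinity>m\<in>{1..}. fourier_cos \<Psi>1 m / real m * cos (real m * x) * sin (real m * t))"
      unfolding solution_eq_dalembert[OF sol x] dalembert_series by (simp add: fourier_sin_0 mult.commute)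
    show "current \<Psi> (x, t) = - fourier_cos \<Psi>1 0 * pi - fourier_cos \<Psi>1 0 * x
        + 2 * (\<Sum>\<^sub>\<infinity>m\<in>{1..}. fourier_cos \<Psi>0 m * sin (real m * x) * sin (real m * t))
        - 2 * (\<Sum>\<^sub>\<infinity>m\<in>{1..}. fourier_cos \<Psi>1 m / real m * sin (real m * x) * cos (real m * t))"
      unfolding current_eq[OF sol x] flux_series by simp
  qed ((rule summable_data; simp) | assumption)+
qed

end
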